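(* Let $\mathcal{S}$ be a finite or countable set, let $p$ be an irreducible and recurrent transition matrix on $\mathcal{S}$ with stationary measure $(m_j)_{j\in\mathcal{S}}$, and let $X=(X_n)_{n\in\mathbb{Z}}$ be the two-sided Markov chain with transition matrix $p$ and initial state $X_0=i$. Let $\nu=(\nu_j)_{j\in\mathcal{S}}$ be a probability measure on $\mathcal{S}$ such that $\nu_i=0$ and $\frac{m_i}{m_j}\nu_j\in\mathbb{Z}$ for all $j\in\mathcal{S}$. Then $$T_*:=\min\Big\{n\ge 0\colon L^i([0,n])\le\sum_{j\in\mathcal{S}}\nu_j\,L^j([0,n])\Big\}$$ is an (almost surely) finite, non-randomized stopping time such that $(X_{n+T_*})_{n\in\mathbb{Z}}$ is a two-sided Markov chain with transition matrix $p$ and $X_{T_*}$ has law $\nu$.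
   Context: An irreducible and recurrent transition matrix $p$ on a finite or countable set $\mathcal{S}$ has a stationary measure $(m_j)_{j\in\mathcal{S}}$ with strictly positive weights, unique up to a positive multiple (finite or infinite total mass). The dual transition matrix is $p^*_{jk}=(m_k/m_j)\,p_{kj}$. The two-sided Markov chain with transition matrix $p$ and initial distribution $\nu$ is the process $(X_n)_{n\in\mathbb{Z}}$ such that $X_0$ has law $\nu$ and, given $X_0$, the processes $(X_n)_{n\ge0}$ and $(X_{-n})_{n\ge0}$ are independent Markov chains started in $X_0$ with transition matrices $p$ and $p^*$, respectively. Its law on $\mathcal{S}^{\mathbb{Z}}$ is denoted $\mathbb{P}_\nu$, and $\mathbb{P}_i=\mathbb{P}_{\delta_i}$ is the law with initial state $X_0=i$. The conclusion says that under $\mathbb{P}_i$ the process $(X_{n+T_*})_{n\in\mathbb{Z}}$ has law $\mathbb{P}_\nu$. The local time at $j\in\mathcal{S}$ is the normalized counting measure $L^j(A)=\frac1{m_j}\#\{n\in A\colon X_n=j\}$ for $A\subset\mathbb{Z}$; intervals $[0,n]$ are intervals of integers. A random time is non-randomized if it is a measurable function of the trajectory $X$. A stopping time is a non-negative random time $T$ with $\{T=n\}\in\sigma(X_k\colon k\le n)$ for all $n\ge0$. *)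

theory Defs
  imports "HOL-Probability.Probability" "HOL-Library.Extended_Nat"
begin

section \<open>Transition matrices on a countable state space\<close>

text \<open>
  The state space is a type of class \<^class>\<open>countable\<close>, i.e. finite or countably infinite.
\<close>

type_synonym 's matrix = "'s \<Rightarrow> 's \<Rightarrow> real"

definition transition_matrix :: "('s::countable) matrix \<Rightarrow> bool" where
  "transition_matrix p \<longleftrightarrow> (\<forall>j k. 0 \<le> p j k) \<and> (\<forall>j. (p j has_sum 1) UNIV)"

primrec n_step :: "('s::countable) matrix \<Rightarrow> nat \<Rightarrow> 's matrix" where
  "n_step p 0 j k = (if j = k then 1 else 0)"
| "n_step p (Suc n) j k = (\<Sum>\<^sub>\<infinity>l. p j l * n_step p n l k)"

definition irreducible_matrix :: "('s::countable) matrix \<Rightarrow> bool" where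
  "irreducible_matrix p \<longleftrightarrow> (\<forall>j k. \<exists>n. n_step p n j k > 0)"

definition stationary_measure :: "('s::countable) matrix \<Rightarrow> ('s \<Rightarrow> real) \<Rightarrow> bool" where
  "stationary_measure p m \<longleftrightarrow>
     (\<forall>j. 0 < m j) \<and> (\<forall>k. ((\<lambda>j. m j * p j k) has_sum m k) UNIV)"

definition dual_matrix :: "('s::countable) matrix \<Rightarrow> ('s \<Rightarrow> real) \<Rightarrow> 's matrix" where
  "dual_matrix p m j k = m k / m j * p k j"


section \<open>Markov chains\<close>

definition markov_chain ::
    "'w measure \<Rightarrow> ('s::countable) matrix \<Rightarrow> 's pmf \<Rightarrow> (nat \<Rightarrow> 'w \<Rightarrow> 's) \<Rightarrow> bool" where
  "markov_chain M p \<nu> X \<longleftrightarrow>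
     prob_space M \<and>
     (\<forall>n. X n \<in> measurable M (count_space UNIV)) \<and>
     distr M (count_space UNIV) (X 0) = measure_pmf \<nu> \<and>
     (\<forall>n x y. \<P>(\<omega> in M. \<forall>k\<le>n. X k \<omega> = x k) > 0 \<longrightarrow>
        \<P>(\<omega> in M. X (Suc n) \<omega> = y \<bar> \<forall>k\<le>n. X k \<omega> = x k) = p (x n) y)"

text \<open>
  Recurrence says that a chain started in \<open>j\<close> almost surely returns to \<open>j\<close>.
  The law of the chain on the path space is unique and always exists, so the quantification
  over \<open>N\<close> below only serves to name that law.
\<close>

definition recurrent_matrix :: "('s::countable) matrix \<Rightarrow> bool" where
  "recurrent_matrix p \<longleftrightarrow>
     (\<forall>j. \<forall>N :: (nat \<Rightarrow> 's) measure.
        sets N = sets (PiM UNIV (\<lambda>_. count_space UNIV)) \<longrightarrow>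
        markov_chain N p (return_pmf j) (\<lambda>n x. x n) \<longrightarrow>
        (AE x in N. \<exists>n\<ge>1. x n = j))"

text \<open>
  Conditioning on the initial state is conditioning on the events \<open>X\<^sub>0 = j\<close> of positive
  probability.
\<close>

definition two_sided_markov_chain ::
    "'w measure \<Rightarrow> ('s::countable) matrix \<Rightarrow> ('s \<Rightarrow> real) \<Rightarrow> 's pmf \<Rightarrow> (int \<Rightarrow> 'w \<Rightarrow> 's) \<Rightarrow> bool"
  where
  "two_sided_markov_chain M p m \<nu> X \<longleftrightarrow>
     prob_space M \<and>
     (\<forall>n. X n \<in> measurable M (count_space UNIV)) \<and>
     distr M (count_space UNIV) (X 0) = measure_pmf \<nu> \<and>
     (\<forall>j\<in>set_pmf \<nu>.
        let M\<^sub>j = uniform_measure M {\<omega> \<in> space M. X 0 \<omega> = j} in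
          markov_chain M\<^sub>j p (return_pmf j) (\<lambda>n. X (int n)) \<and>
          markov_chain M\<^sub>j (dual_matrix p m) (return_pmf j) (\<lambda>n. X (- int n)) \<and>
          prob_space.indep_var M\<^sub>j
            (PiM UNIV (\<lambda>_. count_space UNIV)) (\<lambda>\<omega> n. X (int n) \<omega>)
            (PiM UNIV (\<lambda>_. count_space UNIV)) (\<lambda>\<omega> n. X (- int n) \<omega>))"


section \<open>Random times\<close>

definition nonrandomized :: "'w measure \<Rightarrow> (int \<Rightarrow> 'w \<Rightarrow> 's::countable) \<Rightarrow> ('w \<Rightarrow> enat) \<Rightarrow> bool" where
  "nonrandomized M X T \<longleftrightarrow>
     (\<exists>f \<in> measurable (PiM UNIV (\<lambda>_. count_space UNIV)) (count_space UNIV).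
        \<forall>\<omega>\<in>space M. T \<omega> = f (\<lambda>n. X n \<omega>))"

text \<open>
  The \<open>\<sigma>\<close>-algebra at time \<open>n\<close> contains the whole past, including negative times.
  Times are non-negative because they take values in \<^typ>\<open>enat\<close>.
\<close>

definition chain_stopping_time ::
    "'w measure \<Rightarrow> (int \<Rightarrow> 'w \<Rightarrow> 's::countable) \<Rightarrow> ('w \<Rightarrow> enat) \<Rightarrow> bool" where
  "chain_stopping_time M X T \<longleftrightarrow>
     (\<forall>n::nat. {\<omega> \<in> space M. T \<omega> = enat n} \<in>
        sigma_sets (space M) {X k -` A \<inter> space M | k A. k \<le> int n})"

text \<open>Since \<^const>\<open>card\<close> is \<open>0\<close> on infinite sets, this is only meaningful for finite \<open>A\<close>.\<close>

definition local_time :: "('s \<Rightarrow> real) \<Rightarrow> (int \<Rightarrow> 's::countable) \<Rightarrow> 's \<Rightarrow> int set \<Rightarrow> real" where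
  "local_time m x j A = real (card {n \<in> A. x n = j}) / m j"

text \<open>
  Only the finitely many states visited during \<open>[0,n]\<close> contribute to the sum.
  The infimum is \<open>\<infinity>\<close> if there is no such \<open>n\<close>.
\<close>

definition T_star :: "('s \<Rightarrow> real) \<Rightarrow> 's::countable \<Rightarrow> 's pmf \<Rightarrow> (int \<Rightarrow> 's) \<Rightarrow> enat" where
  "T_star m i \<nu> x =
     (INF n \<in> {n::nat. local_time m x i {0..int n}
                 \<le> (\<Sum>\<^sub>\<infinity>j. pmf \<nu> j * local_time m x j {0..int n})}. enat n)"

text \<open>
  The process seen from a random time; on the event \<open>T = \<infinity>\<close> its value is irrelevant.
\<close>

definition shift_by :: "(int \<Rightarrow> 'w \<Rightarrow> 's) \<Rightarrow> ('w \<Rightarrow> enat) \<Rightarrow> int \<Rightarrow> 'w \<Rightarrow> 's" where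
  "shift_by X T n \<omega> = X (n + int (the_enat (T \<omega>))) \<omega>"

end

theory Submission
  imports Defs
begin

text \<open>
  Put \<open>w j = m i / m j * \<nu> j\<close>, a natural number, and let \<open>S n\<close> be the sum over \<open>k \<le> n\<close> of
  \<open>w (X k)\<close>, minus the number of visits to \<open>i\<close> up to \<open>n\<close>. Then \<open>T\<close> is the first \<open>n\<close>
  with \<open>0 \<le> S n\<close>. Over one excursion from \<open>i\<close> the walk \<open>S\<close> has mean increment zero and it only
  jumps down by one; testing superharmonicity against functions of the level reached by the walk
  shows that \<open>T\<close> is almost surely finite. Letting each visit to \<open>i\<close> point to the place where
  the shift started there stops, a combinatorial count shows that a visit to \<open>j\<close>
  is the target of at most \<open>w j\<close> visits to \<open>i\<close>. Reversing time, this bounds the law of the past seen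
  from \<open>T\<close> by \<open>\<nu>\<close> times the dual transition probabilities. Both are probability measures because
  \<open>T\<close> is finite, so they coincide; the future follows from the Markov property at time \<open>T\<close>.
\<close>

section \<open>Cylinder probabilities of Markov chains\<close>

text \<open>The mean is zero because an excursion from \<open>i\<close> sees \<open>j\<close> on
  average \<open>m j / m i\<close> times, so the expected gain is the sum of all
  \<open>m j / m i * w j = \<nu> j\<close>, which is one, against the single unit lost at
  \<open>i\<close>. The upward jumps may be unbounded and have infinite variance, so finiteness has
  to rest on this first moment alone: the test functions are sums of hitting functions over levels
  up to a cut-off \<open>2 * n\<close>, which stay finite, and the cut-off is removed by monotone
  convergence. Integrality enters through counting: strict minima of an integer walk have distinct
  values, so at most \<open>w j\<close> of them fit into a range of \<open>w j\<close> integers.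
  Reversal makes different visits comparable. Read backwards from time \<open>n\<close>, the
  probability of a path depends on \<open>n\<close> only through the requirement that entry
  \<open>n\<close> of the path is \<open>i\<close>, so all matched visits contribute equal amounts.
  The factor \<open>m (x 0) / m i\<close> left over by the reversal turns the count \<open>w\<close>
  into \<open>\<nu>\<close>.\<close>

lemma sigma_cylinders:
  defines "C \<equiv> {{f::nat \<Rightarrow> 's::countable. map f [0..<n] \<in> S} | n S. True}"
  shows "sets (PiM UNIV (\<lambda>_. count_space UNIV)) = sigma_sets UNIV C" and "Int_stable C"
proof -
  have sing: "{f. f k \<in> A} \<in> C" for k and A :: "'s set"
  proof -
    have "{f. f k \<in> A} = {f. map f [0..<Suc k] \<in> {l. l ! k \<in> A}}"
      by (simp del: upt_Suc)
    then show ?thesis unfolding C_def by blast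
  qed
  have cyl: "{f. map f [0..<n] \<in> S} \<in> sets (PiM UNIV (\<lambda>_. count_space UNIV))"
    for n and S :: "'s list set"
  proof -
    have "{f. map f [0..<n] \<in> S}
        = (\<Union>l\<in>{l\<in>S. length l = n}. \<Inter>k\<in>{..<n}. {f. f k = l ! k})" (is "_ = ?R")
    proof (intro set_eqI iffI)
      fix f assume "f \<in> {f. map f [0..<n] \<in> S}"
      then show "f \<in> ?R" by (intro UN_I[of "map f [0..<n]"]) auto
    next
      fix f assume "f \<in> ?R"
      then obtain l where "l \<in> S" "length l = n" "\<forall>k<n. f k = l ! k" by auto
      then have "map f [0..<n] = l" by (intro nth_equalityI) auto
      then show "f \<in> {f. map f [0..<n] \<in> S}" using \<open>l \<in> S\<close> by simp
    qed
    moreover have "{f. f k = a} \<in> sets (PiM UNIV (\<lambda>_::nat. count_space (UNIV::'s set)))" for k a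
    proof -
      have "(\<lambda>f. f k) -` {a} \<inter> space (PiM UNIV (\<lambda>_::nat. count_space (UNIV::'s set)))
         \<in> sets (PiM UNIV (\<lambda>_. count_space UNIV))"
        by (rule measurable_sets[OF measurable_component_singleton]) auto
      then show ?thesis by (simp add: space_PiM vimage_def)
    qed
    moreover have "(UNIV :: (nat \<Rightarrow> 's) set) \<in> sets (PiM UNIV (\<lambda>_. count_space UNIV))"
      using sets.top[of "PiM UNIV (\<lambda>_::nat. count_space (UNIV::'s set))"] by (simp add: space_PiM)
    ultimately show ?thesis
      by (auto intro!: sets.countable_UN'' sets.countable_INT'' simp: space_PiM)
  qed
  show "sets (PiM UNIV (\<lambda>_. count_space UNIV)) = sigma_sets UNIV C"
  proof
    show "sets (PiM UNIV (\<lambda>_. count_space UNIV)) \<subseteq> sigma_sets UNIV C"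
    proof -
      have "{{f. f k \<in> A} | k A. True} \<subseteq> sigma_sets UNIV C"
        using sing by (auto intro!: sigma_sets.Basic)
      then show ?thesis
        unfolding sets_PiM_single by (simp add: PiE_UNIV_domain sigma_sets_mono)
    qed
    show "sigma_sets UNIV C \<subseteq> sets (PiM UNIV (\<lambda>_. count_space UNIV))"
      using sets.sigma_sets_subset[of C "PiM UNIV (\<lambda>_::nat. count_space (UNIV::'s set))"] cyl
      unfolding C_def by (auto simp: space_PiM)
  qed
  \<comment> \<open>Every cylinder can be rewritten over a longer prefix, so two of them can be
    brought to the common length \<open>max n k\<close> before intersecting. For this the base
    \<open>S\<close> has to be an arbitrary set of lists.\<close>
  have mono: "\<exists>S'. {f. map f [0..<n] \<in> S} = {f. map f [0..<max n k] \<in> S'}"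
    for n k and S :: "'s list set"
    by (intro exI[of _ "{l. take n l \<in> S}"]) (simp add: take_map)
  show "Int_stable C"
  proof (rule Int_stableI)
    fix a b assume "a \<in> C" "b \<in> C"
    then obtain n S k S' where a: "a = {f. map f [0..<n] \<in> S}" and b: "b = {f. map f [0..<k] \<in> S'}"
      unfolding C_def by auto
    from mono[of n S k] obtain U where U: "a = {f. map f [0..<max n k] \<in> U}" using a by auto
    from mono[of k S' n] obtain V where V: "b = {f. map f [0..<max n k] \<in> V}"
      using b by (auto simp: max.commute)
    have "a \<inter> b = {f. map f [0..<max n k] \<in> U \<inter> V}" using U V by auto
    then show "a \<inter> b \<in> C" unfolding C_def by blast
  qed
qed

section \<open>Decomposition over countably many values, and independence of two sequences\<close>

lemma (in finite_measure) countable_fibre_sum: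
  fixes Y :: "'a \<Rightarrow> 'c::countable"
  assumes "Y \<in> measurable M (count_space UNIV)" and "B \<in> sets M"
  shows "emeasure M {\<omega>\<in>B. Y \<omega> \<in> S}
    = (\<integral>\<^sup>+c. emeasure M {\<omega>\<in>B. Y \<omega> = c} \<partial>count_space S)"
proof -
  have meas: "{\<omega>\<in>B. Y \<omega> = c} \<in> sets M" for c
  proof -
    have "Y -` {c} \<inter> space M \<inter> B \<in> sets M"
      using assms by (intro sets.Int measurable_sets[of Y]) auto
    moreover have "Y -` {c} \<inter> space M \<inter> B = {\<omega>\<in>B. Y \<omega> = c}"
      using sets.sets_into_space[OF assms(2)] by auto
    ultimately show ?thesis by simp
  qed
  have "{\<omega>\<in>B. Y \<omega> \<in> S} = (\<Union>c\<in>S. {\<omega>\<in>B. Y \<omega> = c})" by auto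
  also have "emeasure M \<dots> = (\<integral>\<^sup>+c. emeasure M {\<omega>\<in>B. Y \<omega> = c} \<partial>count_space S)"
    by (rule emeasure_UN_countable) (auto simp: meas disjoint_family_on_def)
  finally show ?thesis .
qed

lemma measurable_map_list:
  fixes U :: "'i \<Rightarrow> 'w \<Rightarrow> 's::countable"
  assumes "\<And>k. U k \<in> measurable M (count_space UNIV)"
  shows "(\<lambda>\<omega>. map (\<lambda>k. U k \<omega>) ks) \<in> measurable M (count_space UNIV)"
proof (induction ks)
  case (Cons k ks)
  have "(\<lambda>\<omega>. (case U k \<omega> of x \<Rightarrow> x # map (\<lambda>k. U k \<omega>) ks)) \<in> measurable M (count_space UNIV)"
    using assms[of k] Cons by measurable
  then show ?case by simp
qed simp

lemma measurable_cylinder: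
  fixes U :: "'i \<Rightarrow> 'w \<Rightarrow> 's::countable"
  assumes "\<And>k. U k \<in> measurable M (count_space UNIV)" and "countable I"
  shows "{\<omega>\<in>space M. \<forall>k\<in>I. U k \<omega> = x k} \<in> sets M"
proof -
  have "{\<omega>\<in>space M. U k \<omega> = x k} \<in> sets M" for k
    using measurable_sets[OF assms(1), of "{x k}" k] by (simp add: vimage_def Int_def conj_commute)
  with assms(2) show ?thesis by (intro sets.sets_Collect_countable_All')
qed

text \<open>Chains are specified through finite paths, whereas \<open>indep_var\<close> concerns
  whole sigma-algebras. The product rule passes from single paths to sets of paths by countable
  additivity, and from there to the sigma-algebras because cylinders are closed under
  intersection.\<close>

lemma (in prob_space) indep_var_cylinders:
  fixes U V :: "nat \<Rightarrow> 'a \<Rightarrow> 's::countable"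
  assumes U: "\<And>n. U n \<in> measurable M (count_space UNIV)"
    and V: "\<And>n. V n \<in> measurable M (count_space UNIV)"
    and prod: "\<And>l k x z.
      prob {\<omega>\<in>space M. (\<forall>a\<le>l. U a \<omega> = x a) \<and> (\<forall>b\<le>k. V b \<omega> = z b)}
      = prob {\<omega>\<in>space M. \<forall>a\<le>l. U a \<omega> = x a} * prob {\<omega>\<in>space M. \<forall>b\<le>k. V b \<omega> = z b}"
  shows "indep_var (PiM UNIV (\<lambda>_. count_space UNIV)) (\<lambda>\<omega> n. U n \<omega>)
    (PiM UNIV (\<lambda>_. count_space UNIV)) (\<lambda>\<omega> n. V n \<omega>)"
proof -
  let ?P = "PiM UNIV (\<lambda>_::nat. count_space (UNIV::'s set))"
  define C where "C = {{f::nat \<Rightarrow> 's. map f [0..<n] \<in> S} | n S. True}"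
  define lU where "lU n \<omega> = map (\<lambda>k. U k \<omega>) [0..<n]" for n \<omega>
  define lV where "lV n \<omega> = map (\<lambda>k. V k \<omega>) [0..<n]" for n \<omega>
  have lUm: "lU n \<in> measurable M (count_space UNIV)" for n
    unfolding lU_def by (rule measurable_map_list[OF U])
  have lVm: "lV n \<in> measurable M (count_space UNIV)" for n
    unfolding lV_def by (rule measurable_map_list[OF V])
  have C: "sets ?P = sigma_sets UNIV C" "Int_stable C"
    unfolding C_def by (rule sigma_cylinders)+
  have mU: "(\<lambda>\<omega> n. U n \<omega>) \<in> measurable M ?P" and mV: "(\<lambda>\<omega> n. V n \<omega>) \<in> measurable M ?P"
    using U V by (auto intro!: measurable_PiM_single')
  have sub: "{(\<lambda>\<omega> n. W n \<omega>) -` A \<inter> space M |A. A \<in> C} \<subseteq> Pow (space M)" for W :: "nat \<Rightarrow> 'a \<Rightarrow> 's"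
    by auto
  have gen: "sigma_sets (space M) {(\<lambda>\<omega> n. W n \<omega>) -` A \<inter> space M |A. A \<in> sets ?P}
     = sigma_sets (space M) {(\<lambda>\<omega> n. W n \<omega>) -` A \<inter> space M |A. A \<in> C}" for W :: "nat \<Rightarrow> 'a \<Rightarrow> 's"
  proof -
    have "{(\<lambda>\<omega> n. W n \<omega>) -` A \<inter> space M |A. A \<in> sets ?P}
        = sigma_sets (space M) {(\<lambda>\<omega> n. W n \<omega>) -` A \<inter> space M |A. A \<in> C}"
      unfolding C(1) by (rule sigma_sets_vimage_commute) auto
    then show ?thesis by (simp only: sigma_sets_sigma_sets_eq[OF sub])
  qed
  have stab: "Int_stable {(\<lambda>\<omega> n. W n \<omega>) -` A \<inter> space M |A. A \<in> C}" for W :: "nat \<Rightarrow> 'a \<Rightarrow> 's"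
  proof (rule Int_stableI)
    fix a b assume "a \<in> {(\<lambda>\<omega> n. W n \<omega>) -` A \<inter> space M |A. A \<in> C}"
      "b \<in> {(\<lambda>\<omega> n. W n \<omega>) -` A \<inter> space M |A. A \<in> C}"
    then obtain A B where "A \<in> C" "a = (\<lambda>\<omega> n. W n \<omega>) -` A \<inter> space M"
        "B \<in> C" "b = (\<lambda>\<omega> n. W n \<omega>) -` B \<inter> space M" by auto
    then have "A \<inter> B \<in> C" "a \<inter> b = (\<lambda>\<omega> n. W n \<omega>) -` (A \<inter> B) \<inter> space M"
      using Int_stableD[OF C(2)] by auto
    then show "a \<inter> b \<in> {(\<lambda>\<omega> n. W n \<omega>) -` A \<inter> space M |A. A \<in> C}" by blast
  qed
  have single: "emeasure M {\<omega>\<in>space M. lU n \<omega> = c \<and> lV n' \<omega> = d}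
      = emeasure M {\<omega>\<in>space M. lU n \<omega> = c} * emeasure M {\<omega>\<in>space M. lV n' \<omega> = d}" for n n' c d
  proof -
    have eq: "(map f [0..<n] = c) \<longleftrightarrow> length c = n \<and> (\<forall>a<n. f a = c ! a)"
      for f :: "nat \<Rightarrow> 's" and n c by (auto simp: list_eq_iff_nth_eq)
    have P1: "prob (space M) = 1" by (rule prob_space)
    have lt: "(\<forall>a<Suc n. Q a) \<longleftrightarrow> (\<forall>a\<le>n. Q a)" for n Q by (simp add: less_Suc_eq_le)
    \<comment> \<open>The premise \<open>prod\<close> fixes the entries up to and including
      \<open>l\<close>, so a list of length \<open>n\<close> corresponds to
      \<open>l = n - 1\<close>. The empty list and lists of the wrong length are degenerate: the
      event is then the whole space or empty.\<close>
    have "prob {\<omega>\<in>space M. lU n \<omega> = c \<and> lV n' \<omega> = d}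
      = prob {\<omega>\<in>space M. lU n \<omega> = c} * prob {\<omega>\<in>space M. lV n' \<omega> = d}"
      using prod[of "n - 1" "\<lambda>a. c ! a" "n' - 1" "\<lambda>a. d ! a"] P1 
      by (cases n; cases n'; cases "length c = n"; cases "length d = n'")
         (simp_all add: lU_def lV_def eq lt del: upt_Suc)
    then show ?thesis by (simp add: emeasure_eq_measure ennreal_mult'')
  qed
  have prodS: "emeasure M {\<omega>\<in>space M. lU n \<omega> \<in> S \<and> lV n' \<omega> \<in> S'}
      = emeasure M {\<omega>\<in>space M. lU n \<omega> \<in> S} * emeasure M {\<omega>\<in>space M. lV n' \<omega> \<in> S'}" for n n' S S'
  proof -
    have sV: "{\<omega>\<in>space M. lV n' \<omega> \<in> S'} \<in> sets M" for S'
      using measurable_sets[OF lVm[of n'], of S'] by (simp add: vimage_def Int_def conj_commute)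
    have sU: "{\<omega>\<in>space M. lU n \<omega> = c} \<in> sets M" for c
      using measurable_sets[OF lUm[of n], of "{c}"] by (simp add: vimage_def Int_def conj_commute)
    have "emeasure M {\<omega>\<in>space M. lU n \<omega> \<in> S \<and> lV n' \<omega> \<in> S'}
      = emeasure M {\<omega>\<in>{\<omega>\<in>space M. lV n' \<omega> \<in> S'}. lU n \<omega> \<in> S}"
      by (rule arg_cong[where f="emeasure M"]) auto
    also have "\<dots> = (\<integral>\<^sup>+c. emeasure M {\<omega>\<in>{\<omega>\<in>space M. lV n' \<omega> \<in> S'}. lU n \<omega> = c} \<partial>count_space S)"
      by (rule countable_fibre_sum[OF lUm sV])
    also have "\<dots> = (\<integral>\<^sup>+c. emeasure M {\<omega>\<in>{\<omega>\<in>space M. lU n \<omega> = c}. lV n' \<omega> \<in> S'} \<partial>count_space S)"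
      by (intro nn_integral_cong arg_cong[where f="emeasure M"]) auto
    also have "\<dots> = (\<integral>\<^sup>+c. (\<integral>\<^sup>+d. emeasure M {\<omega>\<in>{\<omega>\<in>space M. lU n \<omega> = c}. lV n' \<omega> = d} \<partial>count_space S') \<partial>count_space S)"
      by (intro nn_integral_cong countable_fibre_sum[OF lVm sU])
    also have "\<dots> = (\<integral>\<^sup>+c. (\<integral>\<^sup>+d. emeasure M {\<omega>\<in>space M. lU n \<omega> = c} * emeasure M {\<omega>\<in>space M. lV n' \<omega> = d} \<partial>count_space S') \<partial>count_space S)"
      using single by (simp add: conj_assoc)
    also have "\<dots> = (\<integral>\<^sup>+c. emeasure M {\<omega>\<in>space M. lU n \<omega> = c} \<partial>count_space S) * (\<integral>\<^sup>+d. emeasure M {\<omega>\<in>space M. lV n' \<omega> = d} \<partial>count_space S')"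
      by (simp add: nn_integral_cmult nn_integral_multc)
    also have "\<dots> = emeasure M {\<omega>\<in>space M. lU n \<omega> \<in> S} * emeasure M {\<omega>\<in>space M. lV n' \<omega> \<in> S'}"
      using countable_fibre_sum[OF lUm sets.top, of n S] countable_fibre_sum[OF lVm sets.top, of n' S']
      by simp
    finally show ?thesis .
  qed
  have "indep_set {(\<lambda>\<omega> n. U n \<omega>) -` A \<inter> space M |A. A \<in> C} {(\<lambda>\<omega> n. V n \<omega>) -` A \<inter> space M |A. A \<in> C}"
  proof (rule indep_setI)
    have "C \<subseteq> sets ?P" unfolding C(1) by auto
    then show "{(\<lambda>\<omega> n. U n \<omega>) -` A \<inter> space M |A. A \<in> C} \<subseteq> events"
      and "{(\<lambda>\<omega> n. V n \<omega>) -` A \<inter> space M |A. A \<in> C} \<subseteq> events"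
      using mU mV by (auto intro: measurable_sets)
    fix a b assume "a \<in> {(\<lambda>\<omega> n. U n \<omega>) -` A \<inter> space M |A. A \<in> C}"
      "b \<in> {(\<lambda>\<omega> n. V n \<omega>) -` A \<inter> space M |A. A \<in> C}"
    then obtain n S n' S' where "a = {\<omega>\<in>space M. lU n \<omega> \<in> S}" "b = {\<omega>\<in>space M. lV n' \<omega> \<in> S'}"
      unfolding C_def lU_def lV_def by (auto simp: vimage_def Int_def conj_commute)
    moreover from this have "a \<inter> b = {\<omega>\<in>space M. lU n \<omega> \<in> S \<and> lV n' \<omega> \<in> S'}" by auto
    ultimately have "emeasure M (a \<inter> b) = emeasure M a * emeasure M b" using prodS by simp
    then show "prob (a \<inter> b) = prob a * prob b"
      by (simp add: measure_def enn2real_mult)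
  qed
  from indep_set_sigma_sets[OF this stab stab] show ?thesis
    unfolding indep_var_eq gen using mU mV by simp
qed

section \<open>Path formulas for one-sided and two-sided chains\<close>

lemma markov_chain_cylinder:
  assumes "markov_chain N p \<nu> Y"
  shows "measure N {\<omega>\<in>space N. \<forall>k\<le>n. Y k \<omega> = y k} = pmf \<nu> (y 0) * (\<Prod>k<n. p (y k) (y (Suc k)))"
proof -
  interpret prob_space N using assms unfolding markov_chain_def by simp
  have Y: "\<And>n. Y n \<in> measurable N (count_space UNIV)" using assms unfolding markov_chain_def by simp
  show ?thesis
  proof (induction n)
    case 0
    have "measure N {\<omega>\<in>space N. Y 0 \<omega> = y 0} = measure (distr N (count_space UNIV) (Y 0)) {y 0}"
      by (subst measure_distr[OF Y]) (auto intro!: arg_cong[where f="measure N"])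
    also have "\<dots> = pmf \<nu> (y 0)" using assms unfolding markov_chain_def by (simp add: pmf.rep_eq)
    finally show ?case by simp
  next
    case (Suc n)
    let ?A = "{\<omega>\<in>space N. \<forall>k\<le>n. Y k \<omega> = y k}"
    have eq: "{\<omega>\<in>space N. \<forall>k\<le>Suc n. Y k \<omega> = y k}
        = {\<omega>\<in>space N. Y (Suc n) \<omega> = y (Suc n) \<and> (\<forall>k\<le>n. Y k \<omega> = y k)}"
      by (auto simp: le_Suc_eq)
    have A: "?A \<in> sets N" using measurable_cylinder[of Y N "{..n}" y] Y by simp
    show ?case
    proof (cases "measure N ?A > 0")
      case True
      then have "measure N {\<omega>\<in>space N. Y (Suc n) \<omega> = y (Suc n) \<and> (\<forall>k\<le>n. Y k \<omega> = y k)} / measure N ?A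
          = p (y n) (y (Suc n))"
        using assms by (simp add: markov_chain_def cond_prob_def)
      then have "measure N {\<omega>\<in>space N. Y (Suc n) \<omega> = y (Suc n) \<and> (\<forall>k\<le>n. Y k \<omega> = y k)}
          = measure N ?A * p (y n) (y (Suc n))"
        using True by (subst (asm) nonzero_divide_eq_eq) (auto simp: mult.commute)
      then show ?thesis unfolding eq using Suc by simp
    next
      \<comment> \<open>Conditional probabilities are prescribed only on events of positive
        probability. Along a null path both sides vanish, the right one because its prefix product
        is zero by induction.\<close>
      case False
      then have "measure N ?A = 0" by (simp add: zero_less_measure_iff)
      moreover have "measure N {\<omega>\<in>space N. \<forall>k\<le>Suc n. Y k \<omega> = y k} \<le> measure N ?A"
        by (rule finite_measure_mono[OF _ A]) auto
      ultimately have "measure N {\<omega>\<in>space N. \<forall>k\<le>Suc n. Y k \<omega> = y k} = 0"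
        by (simp add: measure_le_0_iff)
      moreover have "pmf \<nu> (y 0) * (\<Prod>k<n. p (y k) (y (Suc k))) = 0"
        using \<open>measure N ?A = 0\<close> Suc by simp
      ultimately show ?thesis by auto
    qed
  qed
qed

lemma markov_chainI:
  assumes "prob_space N" and Y: "\<And>n. Y n \<in> measurable N (count_space UNIV)"
    and cyl: "\<And>n y. measure N {\<omega>\<in>space N. \<forall>k\<le>n. Y k \<omega> = y k}
       = pmf \<nu> (y 0) * (\<Prod>k<n. p (y k) (y (Suc k)))"
  shows "markov_chain N p \<nu> Y"
  unfolding markov_chain_def
proof (intro conjI allI impI)
  interpret prob_space N by fact
  show "prob_space N" by fact
  show "Y n \<in> measurable N (count_space UNIV)" for n by (rule Y)
  show "distr N (count_space UNIV) (Y 0) = measure_pmf \<nu>"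
  proof (rule measure_eqI_countable[where A=UNIV])
    fix a :: 'b
    have "emeasure (distr N (count_space UNIV) (Y 0)) {a} = emeasure N {\<omega>\<in>space N. Y 0 \<omega> = a}"
      by (subst emeasure_distr[OF Y]) (auto intro!: arg_cong[where f="emeasure N"])
    then show "emeasure (distr N (count_space UNIV) (Y 0)) {a} = emeasure (measure_pmf \<nu>) {a}"
      using cyl[of 0 "\<lambda>_. a"] by (simp add: emeasure_eq_measure emeasure_pmf_single)
  qed auto
  fix n x y assume pos: "0 < measure N {\<omega>\<in>space N. \<forall>k\<le>n. Y k \<omega> = x k}"
  let ?x = "x(Suc n := y)"
  have eq: "{\<omega>\<in>space N. \<forall>k\<le>Suc n. Y k \<omega> = ?x k}
      = {\<omega>\<in>space N. Y (Suc n) \<omega> = y \<and> (\<forall>k\<le>n. Y k \<omega> = x k)}"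
    by (auto simp: le_Suc_eq)
  have "(\<Prod>k<n. p (?x k) (?x (Suc k))) = (\<Prod>k<n. p (x k) (x (Suc k)))"
    by (intro prod.cong) auto
  then have "measure N {\<omega>\<in>space N. Y (Suc n) \<omega> = y \<and> (\<forall>k\<le>n. Y k \<omega> = x k)}
      = measure N {\<omega>\<in>space N. \<forall>k\<le>n. Y k \<omega> = x k} * p (x n) y"
    unfolding eq[symmetric] cyl by simp
  then show "\<P>(\<omega> in N. Y (Suc n) \<omega> = y \<bar> \<forall>k\<le>n. Y k \<omega> = x k) = p (x n) y"
    unfolding cond_prob_def using pos by simp
qed

text \<open>A joint formula for past and future cylinders contains the initial law, both one-sided
  chains and their conditional independence at once. The two cylinders share time 0, hence the
  restriction to \<open>x 0 = z 0\<close>; otherwise the event is empty.\<close>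

lemma two_sided_markov_chainI:
  fixes \<nu> :: "'s::countable pmf" and Z :: "int \<Rightarrow> 'w \<Rightarrow> 's"
  assumes "prob_space M" and Z: "\<And>n. Z n \<in> measurable M (count_space UNIV)"
    and cyl: "\<And>l k x z. x 0 = z 0 \<Longrightarrow>
      measure M {\<omega>\<in>space M. (\<forall>a\<le>l. Z (- int a) \<omega> = x a) \<and> (\<forall>b\<le>k. Z (int b) \<omega> = z b)}
      = pmf \<nu> (z 0) * (\<Prod>a<l. dual_matrix p m (x a) (x (Suc a))) * (\<Prod>b<k. p (z b) (z (Suc b)))"
  shows "two_sided_markov_chain M p m \<nu> Z"
proof -
  interpret prob_space M by fact
  have fw: "measure M {\<omega>\<in>space M. \<forall>b\<le>k. Z (int b) \<omega> = z b}
      = pmf \<nu> (z 0) * (\<Prod>b<k. p (z b) (z (Suc b)))" for k z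
  proof -
    have "{\<omega>\<in>space M. \<forall>b\<le>k. Z (int b) \<omega> = z b}
      = {\<omega>\<in>space M. (\<forall>a\<le>0. Z (- int a) \<omega> = z a) \<and> (\<forall>b\<le>k. Z (int b) \<omega> = z b)}" by auto
    then show ?thesis using cyl[of z z 0 k] by simp
  qed
  have "markov_chain M p \<nu> (\<lambda>n. Z (int n))"
    by (rule markov_chainI[OF \<open>prob_space M\<close> Z fw])
  then have dist: "distr M (count_space UNIV) (Z 0) = measure_pmf \<nu>"
    unfolding markov_chain_def by simp
  show ?thesis
    unfolding two_sided_markov_chain_def Let_def
  proof (intro conjI ballI allI)
    fix j assume "j \<in> set_pmf \<nu>"
    let ?A = "{\<omega>\<in>space M. Z 0 \<omega> = j}"
    let ?N = "uniform_measure M ?A"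
    have A: "?A \<in> sets M"
      using measurable_cylinder[of "\<lambda>_. Z 0" M "{()}" "\<lambda>_. j"] Z by simp
    have pj: "pmf \<nu> j > 0" using \<open>j \<in> set_pmf \<nu>\<close> by (rule pmf_positive)
    have mA: "measure M ?A = pmf \<nu> j" using fw[of 0 "\<lambda>_. j"] by simp
    have emA: "emeasure M ?A \<noteq> 0" "emeasure M ?A \<noteq> \<infinity>"
      using mA pj by (simp_all add: emeasure_eq_measure)
    interpret N: prob_space ?N by (rule prob_space_uniform_measure[OF emA])
    have ZN: "Z n \<in> measurable ?N (count_space UNIV)" for n
      using Z[of n] by (simp cong: measurable_cong_sets)
    \<comment> \<open>Conditioning on \<open>Z 0 = j\<close> divides out \<open>pmf \<nu> j\<close>.
      What is left is a function of the past times a function of the future, and each marginal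
      follows by taking length 0 on the other side.\<close>
    have cylN: "measure ?N {\<omega>\<in>space M. (\<forall>a\<le>l. Z (- int a) \<omega> = x a) \<and> (\<forall>b\<le>k. Z (int b) \<omega> = z b)}
      = (if x 0 = j \<and> z 0 = j then (\<Prod>a<l. dual_matrix p m (x a) (x (Suc a))) * (\<Prod>b<k. p (z b) (z (Suc b)))
         else 0)" for l k x z
    proof -
      let ?B = "{\<omega>\<in>space M. (\<forall>a\<le>l. Z (- int a) \<omega> = x a) \<and> (\<forall>b\<le>k. Z (int b) \<omega> = z b)}"
      have "?B = {\<omega>\<in>space M. \<forall>a\<in>{..l}. Z (- int a) \<omega> = x a} \<inter> {\<omega>\<in>space M. \<forall>b\<in>{..k}. Z (int b) \<omega> = z b}"
        by auto
      also have "\<dots> \<in> sets M" by (intro sets.Int measurable_cylinder Z) auto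
      finally have B: "?B \<in> sets M" .
      have "measure ?N ?B = measure M (?A \<inter> ?B) / measure M ?A"
        by (rule measure_uniform_measure[OF emA B])
      also have "?A \<inter> ?B = (if x 0 = j \<and> z 0 = j then ?B else {})" by auto
      finally show ?thesis using cyl[of x z l k] mA pj by auto
    qed
    have fwN: "measure ?N {\<omega>\<in>space M. \<forall>b\<le>k. Z (int b) \<omega> = z b}
      = (if z 0 = j then (\<Prod>b<k. p (z b) (z (Suc b))) else 0)" for k z
    proof -
      have "{\<omega>\<in>space M. \<forall>b\<le>k. Z (int b) \<omega> = z b}
        = {\<omega>\<in>space M. (\<forall>a\<le>0. Z (- int a) \<omega> = z a) \<and> (\<forall>b\<le>k. Z (int b) \<omega> = z b)}" by auto
      then show ?thesis using cylN[of 0 z k z] by simp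
    qed
    have bwN: "measure ?N {\<omega>\<in>space M. \<forall>a\<le>l. Z (- int a) \<omega> = x a}
      = (if x 0 = j then (\<Prod>a<l. dual_matrix p m (x a) (x (Suc a))) else 0)" for l x
    proof -
      have "{\<omega>\<in>space M. \<forall>a\<le>l. Z (- int a) \<omega> = x a}
        = {\<omega>\<in>space M. (\<forall>a\<le>l. Z (- int a) \<omega> = x a) \<and> (\<forall>b\<le>0. Z (int b) \<omega> = x b)}" by auto
      then show ?thesis using cylN[of l x 0 x] by simp
    qed
    show "markov_chain ?N p (return_pmf j) (\<lambda>n. Z (int n))"
      by (rule markov_chainI) (simp_all add: N.prob_space_axioms ZN fwN)
    show "markov_chain ?N (dual_matrix p m) (return_pmf j) (\<lambda>n. Z (- int n))"
      by (rule markov_chainI) (simp_all add: N.prob_space_axioms ZN bwN)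
    show "N.indep_var (PiM UNIV (\<lambda>_. count_space UNIV)) (\<lambda>\<omega> n. Z (int n) \<omega>)
      (PiM UNIV (\<lambda>_. count_space UNIV)) (\<lambda>\<omega> n. Z (- int n) \<omega>)"
    proof (rule N.indep_var_cylinders[OF ZN ZN])
      fix l k x z
      have "{\<omega>\<in>space M. (\<forall>a\<le>l. Z (int a) \<omega> = x a) \<and> (\<forall>b\<le>k. Z (- int b) \<omega> = z b)}
        = {\<omega>\<in>space M. (\<forall>b\<le>k. Z (- int b) \<omega> = z b) \<and> (\<forall>a\<le>l. Z (int a) \<omega> = x a)}"
        by auto
      then show "N.prob {\<omega>\<in>space ?N. (\<forall>a\<le>l. Z (int a) \<omega> = x a) \<and> (\<forall>b\<le>k. Z (- int b) \<omega> = z b)}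
        = N.prob {\<omega>\<in>space ?N. \<forall>a\<le>l. Z (int a) \<omega> = x a}
          * N.prob {\<omega>\<in>space ?N. \<forall>b\<le>k. Z (- int b) \<omega> = z b}"
        unfolding space_uniform_measure by (simp only: cylN fwN bwN) simp
    qed
  qed (use dist Z assms(1) in auto)
qed

section \<open>Events determined by finitely many coordinates\<close>

lemma nn_integral_has_sum:
  fixes f :: "'a \<Rightarrow> real"
  assumes f: "(f has_sum s) UNIV" and "\<And>x. 0 \<le> f x"
  shows "(\<integral>\<^sup>+x. ennreal (f x) \<partial>count_space UNIV) = ennreal s"
proof -
  have "Infinite_Sum.abs_summable_on f UNIV"
    using f assms(2) by (simp add: has_sum_imp_summable)
  then have abs: "Infinite_Set_Sum.abs_summable_on f UNIV"
    by (rule abs_summable_equivalent[THEN iffD1])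
  then have "(\<integral>\<^sup>+x. ennreal (f x) \<partial>count_space UNIV) = ennreal (infsetsum f UNIV)"
    by (rule nn_integral_conv_infsetsum) (rule assms(2))
  also have "infsetsum f UNIV = s"
    using infsetsum_infsum[OF abs] infsumI[OF f] by simp
  finally show ?thesis .
qed

locale two_sided_chain = prob_space M for M :: "'w measure" +
  fixes p :: "('s::countable) matrix" and m :: "'s \<Rightarrow> real" and i :: 's
    and X :: "int \<Rightarrow> 'w \<Rightarrow> 's"
  assumes transition: "transition_matrix p"
    and stationary: "stationary_measure p m"
    and chain: "two_sided_markov_chain M p m (return_pmf i) X"
begin

lemma p_nonneg: "0 \<le> p j k"
  using transition unfolding transition_matrix_def by simp

lemma m_pos: "0 < m j"
  using stationary unfolding stationary_measure_def by simp

lemma dual_nonneg: "0 \<le> dual_matrix p m j k"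
  unfolding dual_matrix_def using p_nonneg m_pos by (simp add: less_imp_le)

lemma nn_integral_row: "(\<integral>\<^sup>+k. ennreal (p j k) \<partial>count_space UNIV) = 1"
proof -
  have "(p j has_sum 1) UNIV" using transition unfolding transition_matrix_def by simp
  then have "(\<integral>\<^sup>+k. ennreal (p j k) \<partial>count_space UNIV) = ennreal 1"
    by (intro nn_integral_has_sum) (simp_all add: p_nonneg)
  then show ?thesis by simp
qed

lemma nn_integral_stationary:
  "(\<integral>\<^sup>+j. ennreal (m j) * ennreal (p j k) \<partial>count_space UNIV) = ennreal (m k)"
proof -
  have "((\<lambda>j. m j * p j k) has_sum m k) UNIV"
    using stationary unfolding stationary_measure_def by simp
  then have "(\<integral>\<^sup>+j. ennreal (m j * p j k) \<partial>count_space UNIV) = ennreal (m k)"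
    by (intro nn_integral_has_sum) (simp_all add: p_nonneg less_imp_le[OF m_pos])
  then show ?thesis by (simp add: ennreal_mult' p_nonneg less_imp_le[OF m_pos])
qed

lemma nn_integral_dual_row: "(\<integral>\<^sup>+k. ennreal (dual_matrix p m j k) \<partial>count_space UNIV) = 1"
proof -
  have "(\<integral>\<^sup>+k. ennreal (dual_matrix p m j k) \<partial>count_space UNIV)
      = (\<integral>\<^sup>+k. (ennreal (m k) * ennreal (p k j)) * ennreal (1 / m j) \<partial>count_space UNIV)"
    unfolding dual_matrix_def
    by (intro nn_integral_cong)
       (simp add: ennreal_mult'[symmetric] p_nonneg less_imp_le[OF m_pos] field_simps)
  also have "\<dots> = ennreal (m j) * ennreal (1 / m j)"
    by (simp add: nn_integral_multc nn_integral_stationary)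
  also have "\<dots> = 1"
    using m_pos[of j] by (simp add: ennreal_mult'[symmetric] ennreal_1[symmetric] del: ennreal_1)
  finally show ?thesis .
qed

lemma X_measurable: "X n \<in> measurable M (count_space UNIV)"
  using chain unfolding two_sided_markov_chain_def by simp

lemma AE_start: "AE \<omega> in M. X 0 \<omega> = i"
proof -
  have "distr M (count_space UNIV) (X 0) = measure_pmf (return_pmf i)"
    using chain unfolding two_sided_markov_chain_def by simp
  moreover have "AE x in measure_pmf (return_pmf i). x = i" by (simp add: AE_measure_pmf_iff)
  ultimately have "AE x in distr M (count_space UNIV) (X 0). x = i" by (simp only:)
  then show ?thesis by (subst (asm) AE_distr_iff) (auto simp: X_measurable)
qed

text \<open>The chain starts at \<open>i\<close> almost surely, so the conditioning on the initial
  state that is built into \<open>two_sided_markov_chain\<close> changes no probability.\<close>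

lemma measure_start: "B \<in> sets M \<Longrightarrow> measure (uniform_measure M {\<omega>\<in>space M. X 0 \<omega> = i}) B = prob B"
proof -
  let ?A = "{\<omega>\<in>space M. X 0 \<omega> = i}"
  assume B: "B \<in> sets M"
  have A: "?A \<in> sets M"
    using measurable_cylinder[of "\<lambda>_. X 0" M "{()}" "\<lambda>_. i"] X_measurable by simp
  have A1: "prob ?A = 1" using AE_start by (subst prob_Collect_eq_1) (use A in auto)
  have "measure (uniform_measure M ?A) B = prob (?A \<inter> B) / prob ?A"
    by (rule measure_uniform_measure) (use A1 B in \<open>auto simp: emeasure_eq_measure\<close>)
  also have "\<dots> = prob (?A \<inter> B)" using A1 by simp
  also have "\<dots> = prob B"
    by (rule finite_measure_eq_AE) (use AE_start A B in auto)
  finally show ?thesis .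
qed

section \<open>Joint law of a finite stretch and its time reversal\<close>

definition cyl :: "nat \<Rightarrow> nat \<Rightarrow> (int \<Rightarrow> 's) \<Rightarrow> 'w set" where
  "cyl l n y = {\<omega>\<in>space M. \<forall>k\<in>{- int l..int n}. X k \<omega> = y k}"

lemma cyl_sets: "cyl l n y \<in> sets M"
  unfolding cyl_def by (rule measurable_cylinder[OF X_measurable]) simp

lemma prob_cyl:
  "prob (cyl l n y) = of_bool (y 0 = i) * (\<Prod>k<n. p (y (int k)) (y (int (Suc k))))
     * (\<Prod>a<l. dual_matrix p m (y (- int a)) (y (- int (Suc a))))"
proof -
  let ?A = "{\<omega>\<in>space M. X 0 \<omega> = i}"
  let ?N = "uniform_measure M ?A"
  let ?P = "PiM UNIV (\<lambda>_::nat. count_space (UNIV::'s set))"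
  have fw: "markov_chain ?N p (return_pmf i) (\<lambda>n. X (int n))"
    and bw: "markov_chain ?N (dual_matrix p m) (return_pmf i) (\<lambda>n. X (- int n))"
    and ind: "prob_space.indep_var ?N ?P (\<lambda>\<omega> n. X (int n) \<omega>) ?P (\<lambda>\<omega> n. X (- int n) \<omega>)"
    using chain unfolding two_sided_markov_chain_def by (auto simp: Let_def)
  interpret N: prob_space ?N using fw unfolding markov_chain_def by simp
  have P: "{f. \<forall>k\<le>n. f k = x k} \<in> sets ?P" for n x
  proof -
    have "{f\<in>space ?P. \<forall>k\<in>{..n}. (\<lambda>k f. f k) k f = x k} \<in> sets ?P"
      by (intro measurable_cylinder) auto
    then show ?thesis by (simp add: space_PiM Ball_def)
  qed
  have "cyl l n y = {\<omega>\<in>space M. \<forall>k\<le>n. X (int k) \<omega> = y (int k)}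
      \<inter> {\<omega>\<in>space M. \<forall>k\<le>l. X (- int k) \<omega> = y (- int k)}" (is "_ = ?F \<inter> ?B")
  proof -
    have "(\<forall>k\<in>{- int l..int n}. Q k) \<longleftrightarrow> (\<forall>k\<le>n. Q (int k)) \<and> (\<forall>k\<le>l. Q (- int k))" for Q
    proof
      assume H: "(\<forall>k\<le>n. Q (int k)) \<and> (\<forall>k\<le>l. Q (- int k))"
      show "\<forall>k\<in>{- int l..int n}. Q k"
      proof
        fix k assume "k \<in> {- int l..int n}"
        then show "Q k" using H
          by (cases k rule: int_cases2) auto
      qed
    qed auto
    from this[of "\<lambda>k. X k _ = y k"] show ?thesis
      by (intro set_eqI) (simp only: cyl_def mem_Collect_eq Int_iff conj_ac simp_thms)
  qed
  then have "prob (cyl l n y) = N.prob (?F \<inter> ?B)"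
    using measure_start[OF cyl_sets, of l n y] by (simp only:)
  also have "?F \<inter> ?B = (\<lambda>\<omega>. ((\<lambda>n. X (int n) \<omega>), (\<lambda>n. X (- int n) \<omega>)) ) -`
      ({f. \<forall>k\<le>n. f k = y (int k)} \<times> {f. \<forall>k\<le>l. f k = y (- int k)}) \<inter> space ?N" by auto
  also have "N.prob \<dots> = N.prob ((\<lambda>\<omega> n. X (int n) \<omega>) -` {f. \<forall>k\<le>n. f k = y (int k)} \<inter> space ?N)
      * N.prob ((\<lambda>\<omega> n. X (- int n) \<omega>) -` {f. \<forall>k\<le>l. f k = y (- int k)} \<inter> space ?N)"
    by (rule N.indep_varD[OF ind]) (rule P)+
  also have "((\<lambda>\<omega> n. X (int n) \<omega>) -` {f. \<forall>k\<le>n. f k = y (int k)} \<inter> space ?N)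
     = {\<omega>\<in>space ?N. \<forall>k\<le>n. X (int k) \<omega> = y (int k)}"
    by (rule set_eqI) (simp only: Int_iff vimage_eq mem_Collect_eq conj_commute)
  also have "((\<lambda>\<omega> n. X (- int n) \<omega>) -` {f. \<forall>k\<le>l. f k = y (- int k)} \<inter> space ?N)
     = {\<omega>\<in>space ?N. \<forall>k\<le>l. X (- int k) \<omega> = y (- int k)}"
    by (rule set_eqI) (simp only: Int_iff vimage_eq mem_Collect_eq conj_commute)
  also note markov_chain_cylinder[OF fw, of n "\<lambda>k. y (int k)"]
  also note markov_chain_cylinder[OF bw, of l "\<lambda>k. y (- int k)"]
  finally show ?thesis
    by (cases "y 0 = i") (simp_all del: of_nat_Suc)
qed

text \<open>Time 0 is entry \<open>n\<close> of the reversed path. The steps before that entry are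
  forward transitions; replacing each by its dual produces ratios of \<open>m\<close> that telescope
  to \<open>m (x 0) / m (x n)\<close>. Hence \<open>n\<close> survives only in the condition
  \<open>x n = i\<close>, and one path can be compared across different times.\<close>

lemma prob_reversed_path:
  assumes "n \<le> L"
  shows "prob {\<omega>\<in>space M. \<forall>a\<le>L. X (int n - int a) \<omega> = x a}
    = of_bool (x n = i) * (m (x 0) / m i) * (\<Prod>a<L. dual_matrix p m (x a) (x (Suc a)))"
proof -
  define l where "l = L - n"
  have L: "L = n + l" using assms unfolding l_def by simp
  define y where "y k = x (nat (int n - k))" for k
  have "{\<omega>\<in>space M. \<forall>a\<le>L. X (int n - int a) \<omega> = x a} = cyl l n y"
  proof -
    have "(\<forall>k\<in>{- int l..int n}. X k \<omega> = y k) \<longleftrightarrow> (\<forall>a\<le>L. X (int n - int a) \<omega> = x a)" for \<omega>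
    proof
      assume H: "\<forall>k\<in>{- int l..int n}. X k \<omega> = y k"
      show "\<forall>a\<le>L. X (int n - int a) \<omega> = x a"
      proof (intro allI impI)
        fix a assume "a \<le> L"
        then have "int n - int a \<in> {- int l..int n}" using L by auto
        from H[rule_format, OF this] show "X (int n - int a) \<omega> = x a" by (simp add: y_def)
      qed
    next
      assume H: "\<forall>a\<le>L. X (int n - int a) \<omega> = x a"
      show "\<forall>k\<in>{- int l..int n}. X k \<omega> = y k"
      proof
        fix k assume k: "k \<in> {- int l..int n}"
        then have "nat (int n - k) \<le> L" using L by auto
        from H[rule_format, OF this] k show "X k \<omega> = y k" by (simp add: y_def)
      qed
    qed
    then show ?thesis unfolding cyl_def by auto
  qed
  moreover have "(\<Prod>k<n. p (y (int k)) (y (int (Suc k))))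
      = m (x 0) / m (x n) * (\<Prod>a<n. dual_matrix p m (x a) (x (Suc a)))"
  proof -
    have "(\<Prod>k<n. p (y (int k)) (y (int (Suc k)))) = (\<Prod>k<n. p (x (Suc (n - Suc k))) (x (n - Suc k)))"
    proof (rule prod.cong)
      fix k assume "k \<in> {..<n}"
      then have "nat (int n - int k) = Suc (n - Suc k)" "nat (int n - int (Suc k)) = n - Suc k" by auto
      then show "p (y (int k)) (y (int (Suc k)))
          = p (x (Suc (n - Suc k))) (x (n - Suc k))"
        by (simp only: y_def)
    qed simp
    also have "\<dots> = (\<Prod>a<n. p (x (Suc a)) (x a))"
      by (rule prod.nat_diff_reindex)
    also have "\<dots> = m (x 0) / m (x n) * (\<Prod>a<n. dual_matrix p m (x a) (x (Suc a)))"
    proof (induction n)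
      case 0
      then show ?case using m_pos[of "x 0"] by simp
    next
      case (Suc n)
      have "m (x (Suc n)) \<noteq> 0" "m (x n) \<noteq> 0" using m_pos by (metis less_irrefl)+
      with Suc show ?case by (simp add: dual_matrix_def)
    qed
    finally show ?thesis .
  qed
  moreover have "(\<Prod>a<l. dual_matrix p m (y (- int a)) (y (- int (Suc a))))
      = (\<Prod>a<l. dual_matrix p m (x (n + a)) (x (n + Suc a)))"
  proof (rule prod.cong)
    fix a
    have "nat (int n - - int a) = n + a" "nat (int n - - int (Suc a)) = n + Suc a" by auto
    then show "dual_matrix p m (y (- int a)) (y (- int (Suc a)))
      = dual_matrix p m (x (n + a)) (x (n + Suc a))"
      by (simp only: y_def)
  qed simp
  moreover have "(\<Prod>a<L. dual_matrix p m (x a) (x (Suc a)))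
      = (\<Prod>a<n. dual_matrix p m (x a) (x (Suc a))) * (\<Prod>a<l. dual_matrix p m (x (n + a)) (x (n + Suc a)))"
    unfolding L by (induction l) auto
  moreover have "y 0 = x n" by (simp add: y_def)
  moreover have "of_bool (x n = i) * (m (x 0) / m (x n)) = of_bool (x n = i) * (m (x 0) / m i)"
    by simp
  moreover have "prob (cyl l n y) = of_bool (y 0 = i) * (\<Prod>k<n. p (y (int k)) (y (int (Suc k))))
     * (\<Prod>a<l. dual_matrix p m (y (- int a)) (y (- int (Suc a))))"
    by (rule prob_cyl)
  ultimately show ?thesis by (cases "x n = i") (simp_all del: of_nat_Suc)
qed

section \<open>Events visible in a finite time window\<close>

definition determined :: "nat \<Rightarrow> nat \<Rightarrow> 'w set \<Rightarrow> bool" where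
  "determined l n A \<longleftrightarrow> A \<subseteq> space M \<and>
     (\<forall>\<omega>\<in>space M. \<forall>\<omega>'\<in>space M.
        (\<forall>k\<in>{- int l..int n}. X k \<omega> = X k \<omega>') \<longrightarrow> \<omega> \<in> A \<longrightarrow> \<omega>' \<in> A)"

definition window :: "nat \<Rightarrow> nat \<Rightarrow> 'w \<Rightarrow> 's list" where
  "window l n \<omega> = map (\<lambda>k. X k \<omega>) [- int l..int n]"

lemma window_measurable: "window l n \<in> measurable M (count_space UNIV)"
proof -
  have "window l n = (\<lambda>\<omega>. map (\<lambda>k. X k \<omega>) [- int l..int n])"
    by (rule ext) (rule window_def)
  then show ?thesis using measurable_map_list[of X M, OF X_measurable] by (simp only:)
qed

lemma window_eq_iff: "window l n \<omega> = window l n \<omega>' \<longleftrightarrow> (\<forall>k\<in>{- int l..int n}. X k \<omega> = X k \<omega>')"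
  by (simp only: window_def map_eq_conv set_upto)

lemma determinedI:
  assumes "\<And>\<omega> \<omega>'. \<omega> \<in> space M \<Longrightarrow> \<omega>' \<in> space M \<Longrightarrow> (\<And>k. - int l \<le> k \<Longrightarrow> k \<le> int n \<Longrightarrow> X k \<omega> = X k \<omega>')
    \<Longrightarrow> P \<omega> \<Longrightarrow> P \<omega>'"
  shows "determined l n {\<omega>\<in>space M. P \<omega>}"
  unfolding determined_def
proof (intro conjI ballI impI)
  fix \<omega> \<omega>'
  assume "\<omega> \<in> space M" "\<omega>' \<in> space M" "\<forall>k\<in>{- int l..int n}. X k \<omega> = X k \<omega>'"
    "\<omega> \<in> {\<omega>\<in>space M. P \<omega>}"
  then show "\<omega>' \<in> {\<omega>\<in>space M. P \<omega>}"
    using assms[of \<omega> \<omega>'] by simp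
qed simp

lemma determinedD:
  assumes "determined l n A" "\<omega> \<in> A" "\<omega>' \<in> space M" "window l n \<omega>' = window l n \<omega>"
  shows "\<omega>' \<in> A"
proof -
  have "\<omega> \<in> space M" using assms(1,2) unfolding determined_def by (elim conjE) (rule subsetD)
  moreover have "\<forall>k\<in>{- int l..int n}. X k \<omega> = X k \<omega>'"
    using assms(4)[symmetric] unfolding window_eq_iff .
  ultimately show ?thesis
    using assms(1,2,3) unfolding determined_def by (elim conjE) (drule bspec, assumption, drule bspec, assumption, simp)
qed

lemma determined_Collect:
  assumes A: "determined l n A"
    and P: "\<And>\<omega> \<omega>'. (\<And>k. - int l \<le> k \<Longrightarrow> k \<le> int n \<Longrightarrow> X k \<omega> = X k \<omega>') \<Longrightarrow> P \<omega> \<Longrightarrow> P \<omega>'"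
  shows "determined l n {\<omega>\<in>A. P \<omega>}"
  unfolding determined_def
proof (intro conjI ballI impI)
  show "{\<omega>\<in>A. P \<omega>} \<subseteq> space M"
    using A unfolding determined_def by (elim conjE) (rule subset_trans[OF Collect_subset])
  fix \<omega> \<omega>'
  assume \<omega>': "\<omega>' \<in> space M" and eq: "\<forall>k\<in>{- int l..int n}. X k \<omega> = X k \<omega>'"
    and \<omega>: "\<omega> \<in> {\<omega>\<in>A. P \<omega>}"
  have "window l n \<omega>' = window l n \<omega>"
    unfolding window_eq_iff by (intro ballI) (rule bspec[OF eq, symmetric])
  moreover have "P \<omega>'"
    by (rule P[of \<omega>]) (use \<omega> bspec[OF eq] in simp_all)
  ultimately show "\<omega>' \<in> {\<omega>\<in>A. P \<omega>}"
    using determinedD[OF A _ \<omega>', of \<omega>] \<omega> by simp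
qed

lemma determined_iff:
  assumes "determined l n A"
  shows "\<omega> \<in> A \<longleftrightarrow> \<omega> \<in> space M \<and> window l n \<omega> \<in> window l n ` A"
proof
  show "\<omega> \<in> A \<Longrightarrow> \<omega> \<in> space M \<and> window l n \<omega> \<in> window l n ` A"
    using assms unfolding determined_def by (elim conjE) (intro conjI imageI, rule subsetD)
  assume "\<omega> \<in> space M \<and> window l n \<omega> \<in> window l n ` A"
  then obtain \<omega>' where "\<omega> \<in> space M" "\<omega>' \<in> A" "window l n \<omega> = window l n \<omega>'"
    by (elim conjE imageE)
  then show "\<omega> \<in> A" using determinedD[OF assms] by simp
qed

lemma determined_mono:
  assumes "determined l n A" "l \<le> l'" "n \<le> n'"
  shows "determined l' n' A"
proof -
  have "A \<subseteq> space M" using assms(1) unfolding determined_def by (elim conjE)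
  moreover have "\<omega>' \<in> A" if "\<omega>' \<in> space M" "\<forall>k\<in>{- int l'..int n'}. X k \<omega> = X k \<omega>'" "\<omega> \<in> A" for \<omega> \<omega>'
  proof (rule determinedD[OF assms(1) that(3,1)])
    show "window l n \<omega>' = window l n \<omega>"
      unfolding window_eq_iff
    proof
      fix k assume "k \<in> {- int l..int n}"
      then have "k \<in> {- int l'..int n'}" using assms(2,3) by auto
      then show "X k \<omega>' = X k \<omega>" using bspec[OF that(2)] by simp
    qed
  qed
  ultimately show ?thesis unfolding determined_def by (intro conjI ballI impI)
qed

lemma determined_eq_vimage:
  assumes "determined l n A"
  shows "A = {\<omega>\<in>space M. window l n \<omega> \<in> window l n ` A}"
  by (rule set_eqI, subst mem_Collect_eq) (rule determined_iff[OF assms])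

text \<open>A window takes only countably many values, so dependence on it alone forces
  measurability: the event is the preimage of an arbitrary set of lists. This is what makes the
  purely pointwise definition of \<open>determined\<close> workable.\<close>

lemma determined_sets:
  assumes "determined l n A"
  shows "A \<in> sets M"
proof -
  have "window l n -` (window l n ` A) \<inter> space M \<in> sets M"
    by (rule measurable_sets[OF window_measurable]) simp
  also have "window l n -` (window l n ` A) \<inter> space M = {\<omega>\<in>space M. window l n \<omega> \<in> window l n ` A}"
    by auto
  also have "\<dots> = A" by (rule determined_eq_vimage[OF assms, symmetric])
  finally show ?thesis .
qed

text \<open>The event is a countable union of cylinders, one for each window value, and each
  cylinder uses only coordinates up to \<open>n\<close>. The stopping time property follows from
  this.\<close>

lemma determined_sigma_sets:
  assumes "determined l n A"
  shows "A \<in> sigma_sets (space M) {X k -` B \<inter> space M | k B. k \<le> int n}"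
proof -
  have "{X k -` B \<inter> space M | k B. k \<le> int n} \<subseteq> Pow (space M)" by blast
  then have S: "sigma_algebra (space M) (sigma_sets (space M) {X k -` B \<inter> space M | k B. k \<le> int n})"
    by (rule sigma_algebra_sigma_sets)
  have "(\<Union>c\<in>window l n ` A. {\<omega>\<in>space M. window l n \<omega> = c})
      \<in> sigma_sets (space M) {X k -` B \<inter> space M | k B. k \<le> int n}"
  proof (rule sigma_algebra.countable_UN'[OF S])
    show "(\<lambda>c. {\<omega>\<in>space M. window l n \<omega> = c}) ` window l n ` A
      \<subseteq> sigma_sets (space M) {X k -` B \<inter> space M | k B. k \<le> int n}"
    proof safe
      fix \<omega>0 assume "\<omega>0 \<in> A"
      have "{\<omega>\<in>space M. window l n \<omega> = window l n \<omega>0}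
          = (\<Inter>k\<in>{- int l..int n}. X k -` {X k \<omega>0} \<inter> space M)"
        by (auto simp: window_eq_iff)
      also have "\<dots> \<in> sigma_sets (space M) {X k -` B \<inter> space M | k B. k \<le> int n}"
      proof (intro sigma_algebra.countable_INT'[OF S] image_subsetI)
        fix k assume "k \<in> {- int l..int n}"
        then have "k \<le> int n" by simp
        then have "X k -` {X k \<omega>0} \<inter> space M \<in> {X k -` B \<inter> space M | k B. k \<le> int n}"
          by (intro CollectI exI conjI) (rule refl)
        then show "X k -` {X k \<omega>0} \<inter> space M
          \<in> sigma_sets (space M) {X k -` B \<inter> space M | k B. k \<le> int n}"
          by (rule sigma_sets.Basic)
      qed simp_all
      finally show "{\<omega>\<in>space M. window l n \<omega> = window l n \<omega>0}
        \<in> sigma_sets (space M) {X k -` B \<inter> space M | k B. k \<le> int n}" .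
    qed
  qed simp
  moreover have "(\<Union>c\<in>window l n ` A. {\<omega>\<in>space M. window l n \<omega> = c}) = A"
  proof (rule set_eqI)
    fix \<omega>
    have "\<omega> \<in> (\<Union>c\<in>window l n ` A. {\<omega>\<in>space M. window l n \<omega> = c})
        \<longleftrightarrow> \<omega> \<in> space M \<and> window l n \<omega> \<in> window l n ` A" by (simp add: image_iff)
    then show "\<omega> \<in> (\<Union>c\<in>window l n ` A. {\<omega>\<in>space M. window l n \<omega> = c}) \<longleftrightarrow> \<omega> \<in> A"
      unfolding determined_iff[OF assms, symmetric] .
  qed
  ultimately show ?thesis by simp
qed

text \<open>The Markov property relative to the past with negative times included: for a fixed
  window, appending a state at time \<open>Suc n\<close> multiplies the cylinder probability by
  \<open>p j k\<close> and leaves the backward factors untouched.\<close>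

lemma markov_step:
  assumes A: "determined l n A"
  shows "emeasure M {\<omega>\<in>A. X (int n) \<omega> = j \<and> X (int (Suc n)) \<omega> = k}
    = emeasure M {\<omega>\<in>A. X (int n) \<omega> = j} * ennreal (p j k)"
proof -
  define A' where "A' = {\<omega>\<in>A. X (int n) \<omega> = j}"
  have A': "determined l n A'"
    unfolding A'_def by (rule determined_Collect[OF A]) simp
  let ?B = "{\<omega>\<in>space M. X (int (Suc n)) \<omega> = k}"
  have B: "?B \<in> sets M"
    using measurable_cylinder[of "\<lambda>_. X (int (Suc n))" M "{()}" "\<lambda>_. k"] X_measurable by simp
  have mem: "\<omega> \<in> A' \<longleftrightarrow> \<omega> \<in> space M \<and> window l n \<omega> \<in> window l n ` A'" for \<omega>
    by (rule determined_iff[OF A'])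
  have "{\<omega>\<in>A. X (int n) \<omega> = j \<and> X (int (Suc n)) \<omega> = k} = {\<omega>\<in>A'. X (int (Suc n)) \<omega> = k}"
    unfolding A'_def by blast
  also have "\<dots> = {\<omega>\<in>?B. window l n \<omega> \<in> window l n ` A'}"
    using mem by blast
  finally have "{\<omega>\<in>A. X (int n) \<omega> = j \<and> X (int (Suc n)) \<omega> = k}
    = {\<omega>\<in>?B. window l n \<omega> \<in> window l n ` A'}" .
  then have "emeasure M {\<omega>\<in>A. X (int n) \<omega> = j \<and> X (int (Suc n)) \<omega> = k}
      = (\<integral>\<^sup>+c. emeasure M {\<omega>\<in>?B. window l n \<omega> = c} \<partial>count_space (window l n ` A'))"
    using countable_fibre_sum[OF window_measurable B] by simp
  also have "\<dots> = (\<integral>\<^sup>+c. emeasure M {\<omega>\<in>space M. window l n \<omega> = c} * ennreal (p j k)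
      \<partial>count_space (window l n ` A'))"
  proof (rule nn_integral_cong)
    fix c assume "c \<in> space (count_space (window l n ` A'))"
    then obtain \<omega>0 where w0: "\<omega>0 \<in> A'" "c = window l n \<omega>0" by auto
    define y where "y = (\<lambda>r. X r \<omega>0)"
    define y' where "y' = y(int (Suc n) := k)"
    have c1: "{\<omega>\<in>space M. window l n \<omega> = c} = cyl l n y"
      unfolding w0(2) window_eq_iff cyl_def y_def ..
    have c2: "{\<omega>\<in>?B. window l n \<omega> = c} = cyl l (Suc n) y'"
    proof -
      have "{- int l..int (Suc n)} = insert (int (Suc n)) {- int l..int n}" by auto
      then show ?thesis unfolding w0(2) window_eq_iff cyl_def y_def y'_def by auto
    qed
    have y'0: "y' 0 = y 0" unfolding y'_def by auto
    have 1: "(\<Prod>k<n. p (y' (int k)) (y' (int (Suc k)))) = (\<Prod>k<n. p (y (int k)) (y (int (Suc k))))"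
      by (intro prod.cong) (auto simp: y'_def)
    have 2: "(\<Prod>a<l. dual_matrix p m (y' (- int a)) (y' (- int (Suc a))))
      = (\<Prod>a<l. dual_matrix p m (y (- int a)) (y (- int (Suc a))))"
      by (intro prod.cong) (auto simp: y'_def)
    have 3: "y' (int n) = j" "y' (int (Suc n)) = k"
      using w0(1) unfolding y'_def y_def A'_def by auto
    have "prob (cyl l (Suc n) y') = prob (cyl l n y) * p j k"
      unfolding prob_cyl prod.lessThan_Suc 1 2 3 y'0 by simp
    then show "emeasure M {\<omega>\<in>?B. window l n \<omega> = c}
      = emeasure M {\<omega>\<in>space M. window l n \<omega> = c} * ennreal (p j k)"
      unfolding c1 c2 by (simp add: emeasure_eq_measure ennreal_mult' p_nonneg)
  qed
  also have "\<dots> = emeasure M {\<omega>\<in>space M. window l n \<omega> \<in> window l n ` A'} * ennreal (p j k)"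
    using countable_fibre_sum[OF window_measurable sets.top, of l n] by (simp add: nn_integral_multc)
  also have "{\<omega>\<in>space M. window l n \<omega> \<in> window l n ` A'} = {\<omega>\<in>A. X (int n) \<omega> = j}"
    using determined_eq_vimage[OF A', symmetric] unfolding A'_def .
  finally show ?thesis .
qed

end

section \<open>Excursions and superharmonic functions\<close>

text \<open>A positive \<open>n\<close>-step probability yields a sequence of positive single steps
  from \<open>j\<close> to \<open>k\<close>, so a property inherited backwards along single steps
  spreads from one state to all.\<close>

lemma irreducible_backward_induct:
  assumes "irreducible_matrix p" and nonneg: "\<And>j k. 0 \<le> p j k"
    and step: "\<And>j k. 0 < p j k \<Longrightarrow> Q k \<Longrightarrow> Q j" and "Q k"
  shows "Q j"
proof -
  have nn: "0 \<le> n_step p n j k" for n j k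
    by (induction n arbitrary: j) (auto intro!: infsum_nonneg simp: nonneg)
  have "0 < n_step p n j k \<Longrightarrow> Q j" for n
  proof (induction n arbitrary: j)
    case 0
    then show ?case using \<open>Q k\<close> by (simp split: if_splits)
  next
    case (Suc n)
    have "\<exists>l. p j l * n_step p n l k \<noteq> 0"
    proof (rule ccontr)
      assume "\<not> (\<exists>l. p j l * n_step p n l k \<noteq> 0)"
      then have "(\<Sum>\<^sub>\<infinity>l. p j l * n_step p n l k) = 0" by (intro infsum_0) blast
      then show False using Suc.prems by simp
    qed
    then obtain l where "p j l \<noteq> 0" "n_step p n l k \<noteq> 0" by auto
    then have "0 < p j l" "0 < n_step p n l k" using nonneg[of j l] nn[of n l k] by simp_all
    then show ?case using Suc.IH step by blast
  qed
  then show ?thesis using assms(1) unfolding irreducible_matrix_def by blast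
qed

lemma nn_integral_count_space_commute:
  "(\<integral>\<^sup>+x. (\<integral>\<^sup>+y. f x y \<partial>count_space UNIV) \<partial>count_space UNIV)
   = (\<integral>\<^sup>+y. (\<integral>\<^sup>+x. f x y \<partial>count_space UNIV) \<partial>count_space UNIV)"
  using nn_integral_fst_count_space[of "\<lambda>(x, y). f x y"]
    nn_integral_snd_count_space[of "\<lambda>(x, y). f x y"] by simp

lemma nn_integral_count_space_eq_0_iff:
  "(\<integral>\<^sup>+x. f x \<partial>count_space UNIV) = 0 \<longleftrightarrow> (\<forall>x. f x = 0)"
  by (subst nn_integral_0_iff_AE) (auto simp: AE_count_space)

lemma nn_integral_count_space_split:
  fixes f :: "'a::countable \<Rightarrow> ennreal"
  shows "(\<integral>\<^sup>+x. f x \<partial>count_space UNIV) = f a + (\<integral>\<^sup>+x. (if x = a then 0 else f x) \<partial>count_space UNIV)"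
proof -
  have "(\<integral>\<^sup>+x. f x \<partial>count_space UNIV)
    = (\<integral>\<^sup>+x. f a * indicator {a} x + (if x = a then 0 else f x) \<partial>count_space UNIV)"
    by (intro nn_integral_cong) (simp add: indicator_def)
  also have "\<dots> = (\<integral>\<^sup>+x. f a * indicator {a} x \<partial>count_space UNIV)
     + (\<integral>\<^sup>+x. (if x = a then 0 else f x) \<partial>count_space UNIV)"
    by (rule nn_integral_add) simp_all
  also have "(\<integral>\<^sup>+x. f a * indicator {a} x \<partial>count_space UNIV) = f a"
    by (subst nn_integral_cmult_indicator) simp_all
  finally show ?thesis .
qed

locale recurrent_two_sided_chain = two_sided_chain +
  assumes irreducible: "irreducible_matrix p" and recurrent: "recurrent_matrix p"
begin

text \<open>Recurrence is stated for laws on path space, so it is applied to the image of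
  \<open>M\<close> under the forward trajectory.\<close>

lemma AE_return: "AE \<omega> in M. \<exists>n\<ge>1. X (int n) \<omega> = i"
proof -
  let ?P = "PiM UNIV (\<lambda>_::nat. count_space (UNIV::'b set))"
  let ?N = "distr M ?P (\<lambda>\<omega> n. X (int n) \<omega>)"
  have meas: "(\<lambda>\<omega> n. X (int n) \<omega>) \<in> measurable M ?P"
    by (intro measurable_PiM_single') (auto simp: X_measurable)
  interpret N: prob_space ?N by (rule prob_space_distr[OF meas])
  have "markov_chain ?N p (return_pmf i) (\<lambda>n x. x n)"
  proof (rule markov_chainI)
    show "prob_space ?N" by (rule N.prob_space_axioms)
    show "(\<lambda>x. x n) \<in> measurable ?N (count_space UNIV)" for n by simp
    fix n y
    have "{x\<in>space ?P. \<forall>k\<in>{..n}. (\<lambda>k x. x k) k x = y k} \<in> sets ?P"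
      by (intro measurable_cylinder) auto
    then have S: "{x\<in>space ?N. \<forall>k\<le>n. x k = y k} \<in> sets ?P" by (simp add: Ball_def)
    have "measure ?N {x\<in>space ?N. \<forall>k\<le>n. x k = y k}
        = prob ((\<lambda>\<omega> n. X (int n) \<omega>) -` {x\<in>space ?N. \<forall>k\<le>n. x k = y k} \<inter> space M)"
      by (rule measure_distr[OF meas S])
    also have "(\<lambda>\<omega> n. X (int n) \<omega>) -` {x\<in>space ?N. \<forall>k\<le>n. x k = y k} \<inter> space M = cyl 0 n (\<lambda>k. y (nat k))"
    proof -
      have "(\<forall>k\<in>{- int 0..int n}. X k \<omega> = y (nat k)) \<longleftrightarrow> (\<forall>k\<le>n. X (int k) \<omega> = y k)" for \<omega>
      proof
        assume H: "\<forall>k\<in>{- int 0..int n}. X k \<omega> = y (nat k)"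
        show "\<forall>k\<le>n. X (int k) \<omega> = y k"
        proof (intro allI impI)
          fix k assume "k \<le> n"
          then show "X (int k) \<omega> = y k" using bspec[OF H, of "int k"] by simp
        qed
      next
        assume H: "\<forall>k\<le>n. X (int k) \<omega> = y k"
        show "\<forall>k\<in>{- int 0..int n}. X k \<omega> = y (nat k)"
        proof
          fix k assume "k \<in> {- int 0..int n}"
          then have "0 \<le> k" "nat k \<le> n" by auto
          then show "X k \<omega> = y (nat k)" using H[rule_format, of "nat k"] by simp
        qed
      qed
      then show ?thesis unfolding cyl_def by (intro set_eqI) (simp add: space_PiM conj_commute)
    qed
    also have "prob \<dots> = pmf (return_pmf i) (y 0) * (\<Prod>k<n. p (y k) (y (Suc k)))"
      unfolding prob_cyl by (simp add: indicator_def del: of_nat_Suc)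
    finally show "measure ?N {x\<in>space ?N. \<forall>k\<le>n. x k = y k}
      = pmf (return_pmf i) (y 0) * (\<Prod>k<n. p (y k) (y (Suc k)))" .
  qed
  then have "AE x in ?N. \<exists>n\<ge>1. x n = i"
    using recurrent unfolding recurrent_matrix_def by (elim allE[of _ i] allE[of _ ?N]) simp
  then show ?thesis by (rule AE_distrD[OF meas])
qed

section \<open>Taboo probabilities and the occupation measure of one excursion\<close>

definition no_return :: "nat \<Rightarrow> 'a set" where
  "no_return n = {\<omega>\<in>space M. \<forall>k\<in>{1..int n}. X k \<omega> \<noteq> i}"

lemma determined_no_return: "determined 0 n (no_return n)"
  unfolding no_return_def by (rule determinedI) simp

definition taboo :: "nat \<Rightarrow> 'b \<Rightarrow> ennreal" where
  "taboo n j = emeasure M {\<omega>\<in>no_return n. X (int n) \<omega> = j}"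

text \<open>Index \<open>n\<close> stands for a first return at time \<open>Suc n\<close>; this
  aligns it with \<open>taboo n\<close>, one step before the return.\<close>

definition first_return :: "nat \<Rightarrow> ennreal" where
  "first_return n = emeasure M {\<omega>\<in>no_return n. X (int (Suc n)) \<omega> = i}"

lemma taboo_0: "taboo 0 j = of_bool (j = i)"
proof -
  have S: "{\<omega>\<in>space M. X 0 \<omega> = j} \<in> sets M"
    using measurable_cylinder[of "\<lambda>_. X 0" M "{()}" "\<lambda>_. j"] X_measurable by simp
  have "emeasure M {\<omega>\<in>space M. X 0 \<omega> = j} = emeasure M (if j = i then space M else {})"
    by (rule emeasure_eq_AE) (use AE_start S in auto)
  then show ?thesis
    unfolding taboo_def no_return_def by (simp add: emeasure_space_1)
qed

lemma emeasure_no_return_step: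
  "emeasure M {\<omega>\<in>no_return n. X (int (Suc n)) \<omega> = k} = (\<integral>\<^sup>+j. taboo n j * ennreal (p j k) \<partial>count_space UNIV)"
proof -
  have S: "{\<omega>\<in>no_return n. X (int (Suc n)) \<omega> = k} \<in> sets M"
  proof -
    have "no_return n \<inter> (X (int (Suc n)) -` {k} \<inter> space M) \<in> sets M"
      by (intro sets.Int determined_sets[OF determined_no_return] measurable_sets[OF X_measurable]) simp
    also have "no_return n \<inter> (X (int (Suc n)) -` {k} \<inter> space M) = {\<omega>\<in>no_return n. X (int (Suc n)) \<omega> = k}"
      unfolding no_return_def by auto
    finally show ?thesis .
  qed
  have "emeasure M {\<omega>\<in>no_return n. X (int (Suc n)) \<omega> = k}
      = emeasure M {\<omega>\<in>{\<omega>\<in>no_return n. X (int (Suc n)) \<omega> = k}. X (int n) \<omega> \<in> UNIV}" by simp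
  also have "\<dots> = (\<integral>\<^sup>+j. emeasure M {\<omega>\<in>{\<omega>\<in>no_return n. X (int (Suc n)) \<omega> = k}. X (int n) \<omega> = j} \<partial>count_space UNIV)"
    by (rule countable_fibre_sum[OF X_measurable S])
  also have "\<dots> = (\<integral>\<^sup>+j. taboo n j * ennreal (p j k) \<partial>count_space UNIV)"
  proof (rule nn_integral_cong)
    fix j
    have "{\<omega>\<in>{\<omega>\<in>no_return n. X (int (Suc n)) \<omega> = k}. X (int n) \<omega> = j}
      = {\<omega>\<in>no_return n. X (int n) \<omega> = j \<and> X (int (Suc n)) \<omega> = k}" by (simp only: mem_Collect_eq conj_ac)
    then show "emeasure M {\<omega>\<in>{\<omega>\<in>no_return n. X (int (Suc n)) \<omega> = k}. X (int n) \<omega> = j}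
      = taboo n j * ennreal (p j k)"
      unfolding taboo_def by (simp only: markov_step[OF determined_no_return])
  qed
  finally show ?thesis .
qed

lemma first_return_eq: "first_return n = (\<integral>\<^sup>+j. taboo n j * ennreal (p j i) \<partial>count_space UNIV)"
  unfolding first_return_def by (rule emeasure_no_return_step)

lemma taboo_Suc:
  "taboo (Suc n) k = (if k = i then 0 else \<integral>\<^sup>+j. taboo n j * ennreal (p j k) \<partial>count_space UNIV)"
proof -
  have "{1..int (Suc n)} = insert (int (Suc n)) {1..int n}" by auto
  then have "{\<omega>\<in>no_return (Suc n). X (int (Suc n)) \<omega> = k}
    = (if k = i then {} else {\<omega>\<in>no_return n. X (int (Suc n)) \<omega> = k})"
    unfolding no_return_def by auto
  then show ?thesis unfolding taboo_def using emeasure_no_return_step[of n k, unfolded taboo_def] by simp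
qed

lemma suminf_first_return: "(\<Sum>n. first_return n) = 1"
proof -
  let ?R = "\<lambda>n. {\<omega>\<in>no_return n. X (int (Suc n)) \<omega> = i}"
  have sets: "?R n \<in> sets M" for n
  proof -
    have "no_return n \<inter> (X (int (Suc n)) -` {i} \<inter> space M) \<in> sets M"
      by (intro sets.Int determined_sets[OF determined_no_return] measurable_sets[OF X_measurable]) simp
    also have "no_return n \<inter> (X (int (Suc n)) -` {i} \<inter> space M) = ?R n"
      unfolding no_return_def by auto
    finally show ?thesis .
  qed
  have disj: "?R a \<inter> ?R b = {}" if "a < b" for a b
  proof -
    have "int (Suc a) \<in> {1..int b}" using that by auto
    then show ?thesis unfolding no_return_def by blast
  qed
  have "disjoint_family ?R"
    unfolding disjoint_family_on_def
  proof (intro ballI impI)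
    fix a b :: nat assume "a \<noteq> b"
    then consider "a < b" | "b < a" by linarith
    then show "?R a \<inter> ?R b = {}"
      by cases (rule disj, assumption, subst Int_commute, rule disj)
  qed
  then have "(\<Sum>n. first_return n) = emeasure M (\<Union>n. ?R n)"
    unfolding first_return_def using sets by (intro suminf_emeasure) auto
  also have "\<dots> = emeasure M (space M)"
  proof (rule emeasure_eq_AE)
    show "AE \<omega> in M. \<omega> \<in> (\<Union>n. ?R n) \<longleftrightarrow> \<omega> \<in> space M"
      using AE_return AE_space
    proof eventually_elim
      case (elim \<omega>)
      define n where "n = (LEAST n. 1 \<le> n \<and> X (int n) \<omega> = i)"
      have n: "1 \<le> n" "X (int n) \<omega> = i"
        using LeastI_ex[OF elim(1)] unfolding n_def by auto
      have "X (int k) \<omega> \<noteq> i" if "1 \<le> k" "k < n" for k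
        using not_less_Least[of k "\<lambda>n. 1 \<le> n \<and> X (int n) \<omega> = i"] that unfolding n_def by blast
      then have "X k \<omega> \<noteq> i" if "k \<in> {1..int (n - 1)}" for k
        using that n(1) by (cases k rule: int_cases2) auto
      then have "\<omega> \<in> ?R (n - 1)" using n elim(2) unfolding no_return_def by simp
      then show ?case using elim(2) by blast
    qed
  qed (use sets in auto)
  finally show ?thesis by (simp add: emeasure_space_1)
qed

text \<open>The expected number of visits to \<open>j\<close> strictly before the first return to
  \<open>i\<close>, with time 0 included.\<close>

definition occupation :: "'b \<Rightarrow> ennreal" where
  "occupation j = (\<Sum>n. taboo n j)"

lemma suminf_taboo_step:
  "(\<Sum>n. \<integral>\<^sup>+j. taboo n j * ennreal (p j k) \<partial>count_space UNIV)
    = (\<integral>\<^sup>+j. occupation j * ennreal (p j k) \<partial>count_space UNIV)"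
  unfolding occupation_def
  by (simp add: nn_integral_suminf[symmetric])

lemma occupation_off_start: "j \<noteq> i \<Longrightarrow> occupation j = (\<Sum>n. taboo (Suc n) j)"
  unfolding occupation_def
  using suminf_offset[of "\<lambda>n. taboo n j" 1] by (simp add: taboo_0)

lemma occupation_start: "occupation i = 1"
  unfolding occupation_def
  using suminf_offset[of "\<lambda>n. taboo n i" 1] by (simp add: taboo_0 taboo_Suc)

text \<open>Moving all times of an excursion by one replaces the initial visit to \<open>i\<close>
  by the final one, and these have equal mass because the return is almost sure.\<close>

lemma occupation_stationary:
  "(\<integral>\<^sup>+j. occupation j * ennreal (p j k) \<partial>count_space UNIV) = occupation k"
proof (cases "k = i")
  case True
  then show ?thesis
    using suminf_taboo_step[of i] suminf_first_return occupation_start by (simp add: first_return_eq)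
next
  case False
  then show ?thesis
    using suminf_taboo_step[of k] occupation_off_start[of k] by (simp add: taboo_Suc)
qed

text \<open>Induction on the number of terms: away from \<open>i\<close>, one more term amounts to
  one more transition applied to the truncated sum, and \<open>m\<close> is preserved by
  transitions. At \<open>i\<close> only time 0 contributes.\<close>

lemma occupation_le: "ennreal (m i) * occupation j \<le> ennreal (m j)"
proof -
  have "ennreal (m i) * (\<Sum>n<N. taboo n j) \<le> ennreal (m j)" for N
  proof (induction N arbitrary: j)
    case (Suc N)
    have shift: "(\<Sum>n<Suc N. taboo n j) = taboo 0 j + (\<Sum>n<N. taboo (Suc n) j)"
      by (rule sum.lessThan_Suc_shift)
    show ?case
    proof (cases "j = i")
      case True
      then show ?thesis unfolding shift by (simp add: taboo_0 taboo_Suc)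
    next
      case False
      then have "ennreal (m i) * (\<Sum>n<Suc N. taboo n j)
          = ennreal (m i) * (\<Sum>n<N. \<integral>\<^sup>+k. taboo n k * ennreal (p k j) \<partial>count_space UNIV)"
        unfolding shift by (simp add: taboo_0 taboo_Suc)
      also have "\<dots> = (\<integral>\<^sup>+k. (ennreal (m i) * (\<Sum>n<N. taboo n k)) * ennreal (p k j) \<partial>count_space UNIV)"
        by (simp add: nn_integral_sum[symmetric] nn_integral_cmult[symmetric] sum_distrib_right mult.assoc)
      also have "\<dots> \<le> (\<integral>\<^sup>+k. ennreal (m k) * ennreal (p k j) \<partial>count_space UNIV)"
        by (intro nn_integral_mono mult_right_mono Suc.IH) simp
      finally show ?thesis unfolding nn_integral_stationary .
    qed
  qed simp
  then have "(\<Sum>n. ennreal (m i) * taboo n j) \<le> ennreal (m j)"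
    by (intro suminf_le_const summableI) (simp add: sum_distrib_left)
  then show ?thesis unfolding occupation_def by simp
qed

text \<open>Uniqueness of the stationary measure: the difference \<open>D\<close> is nonnegative,
  invariant and zero at \<open>i\<close>. Invariance makes it zero at every state with a positive
  step into a zero of \<open>D\<close>, hence everywhere.\<close>

lemma occupation_eq: "ennreal (m i) * occupation j = ennreal (m j)"
proof -
  define D where "D j = ennreal (m j) - ennreal (m i) * occupation j" for j
  have split: "ennreal (m j) = ennreal (m i) * occupation j + D j" for j
    unfolding D_def using occupation_le[of j] by (simp add: add_diff_inverse_ennreal)
  have fin: "ennreal (m i) * occupation j \<noteq> \<top>" for j
    using occupation_le[of j] by (metis ennreal_neq_top neq_top_trans)
  have D: "(\<integral>\<^sup>+j. D j * ennreal (p j k) \<partial>count_space UNIV) = D k" for k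
  proof -
    have "ennreal (m i) * occupation k + D k = (\<integral>\<^sup>+j. ennreal (m j) * ennreal (p j k) \<partial>count_space UNIV)"
      unfolding nn_integral_stationary split[symmetric] ..
    also have "\<dots> = (\<integral>\<^sup>+j. ennreal (m i) * (occupation j * ennreal (p j k)) + D j * ennreal (p j k) \<partial>count_space UNIV)"
      by (subst split) (simp add: algebra_simps)
    also have "\<dots> = ennreal (m i) * (\<integral>\<^sup>+j. occupation j * ennreal (p j k) \<partial>count_space UNIV)
        + (\<integral>\<^sup>+j. D j * ennreal (p j k) \<partial>count_space UNIV)"
      by (subst nn_integral_add) (simp_all add: nn_integral_cmult)
    finally show ?thesis unfolding occupation_stationary
      using fin[of k] by (simp add: ennreal_add_left_cancel)
  qed
  have "D j = 0"
  proof (rule irreducible_backward_induct[where Q="\<lambda>j. D j = 0" and k=i, OF irreducible p_nonneg])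
    show "D i = 0" unfolding D_def by (simp add: occupation_start)
    fix j k assume "0 < p j k" "D k = 0"
    then have "D j * ennreal (p j k) = 0"
      using D[of k] by (simp only: nn_integral_count_space_eq_0_iff)
    then show "D j = 0" using \<open>0 < p j k\<close> by simp
  qed
  then show ?thesis using split[of j] by simp
qed

section \<open>Superharmonic functions of the recurrent chain\<close>

definition step_op :: "('b \<Rightarrow> ennreal) \<Rightarrow> 'b \<Rightarrow> ennreal" where
  "step_op h j = (\<integral>\<^sup>+k. ennreal (p j k) * h k \<partial>count_space UNIV)"

lemma step_op_mono: "(\<And>k. h k \<le> h' k) \<Longrightarrow> step_op h j \<le> step_op h' j"
  unfolding step_op_def by (intro nn_integral_mono mult_left_mono) auto

lemma step_op_const: "step_op (\<lambda>_. c) j = c"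
  unfolding step_op_def by (simp add: nn_integral_multc nn_integral_row)

lemma step_op_add: "step_op (\<lambda>k. h k + h' k) j = step_op h j + step_op h' j"
  unfolding step_op_def by (simp add: distrib_left nn_integral_add)

text \<open>
  Summing a superharmonic function along an excursion from \<open>i\<close>, its defect \<open>g\<close> is
  weighted by the expected occupation of the excursion.
\<close>
lemma excursion_inequality:
  assumes h: "\<And>j. j \<noteq> i \<Longrightarrow> step_op h j + g j \<le> h j"
  shows "h i + (\<integral>\<^sup>+j. (if j = i then 0 else occupation j * g j) \<partial>count_space UNIV) \<le> step_op h i"
proof -
  define A where "A n = (\<integral>\<^sup>+j. taboo n j * h j \<partial>count_space UNIV)" for n
  define G where "G n = (\<integral>\<^sup>+j. taboo n j * g j \<partial>count_space UNIV)" for n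
  \<comment> \<open>A step from a point of the excursion either continues it, which gives
    \<open>A (Suc n)\<close>, or closes it at \<open>i\<close>, where the value \<open>h i\<close>
    is collected.\<close>
  have push: "(\<integral>\<^sup>+j. taboo n j * step_op h j \<partial>count_space UNIV) = A (Suc n) + first_return n * h i" for n
  proof -
    have "(\<integral>\<^sup>+j. taboo n j * step_op h j \<partial>count_space UNIV)
      = (\<integral>\<^sup>+j. (\<integral>\<^sup>+k. taboo n j * ennreal (p j k) * h k \<partial>count_space UNIV) \<partial>count_space UNIV)"
      unfolding step_op_def by (simp add: nn_integral_cmult[symmetric] mult.assoc)
    also have "\<dots> = (\<integral>\<^sup>+k. (\<integral>\<^sup>+j. taboo n j * ennreal (p j k) * h k \<partial>count_space UNIV) \<partial>count_space UNIV)"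
      by (rule nn_integral_count_space_commute)
    also have "\<dots> = (\<integral>\<^sup>+k. (\<integral>\<^sup>+j. taboo n j * ennreal (p j k) \<partial>count_space UNIV) * h k \<partial>count_space UNIV)"
      by (simp add: nn_integral_multc)
    also have "\<dots> = first_return n * h i + (\<integral>\<^sup>+k. (if k = i then 0
        else (\<integral>\<^sup>+j. taboo n j * ennreal (p j k) \<partial>count_space UNIV) * h k) \<partial>count_space UNIV)"
      unfolding first_return_eq by (rule nn_integral_count_space_split)
    also have "(\<integral>\<^sup>+k. (if k = i then 0 else (\<integral>\<^sup>+j. taboo n j * ennreal (p j k) \<partial>count_space UNIV) * h k) \<partial>count_space UNIV)
       = A (Suc n)"
      unfolding A_def by (intro nn_integral_cong) (simp add: taboo_Suc)
    finally show ?thesis by (simp add: add.commute)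
  qed
  have start: "step_op h i = A 1 + first_return 0 * h i"
  proof -
    have "(\<integral>\<^sup>+j. taboo 0 j * step_op h j \<partial>count_space UNIV) = step_op h i"
      by (subst nn_integral_count_space_split[where a=i])
         (simp add: taboo_0 nn_integral_count_space_eq_0_iff cong: if_cong)
    then show ?thesis using push[of 0] by simp
  qed
  have step: "A (Suc (Suc n)) + first_return (Suc n) * h i + G (Suc n) \<le> A (Suc n)" for n
  proof -
    have "(\<integral>\<^sup>+j. taboo (Suc n) j * step_op h j \<partial>count_space UNIV) + G (Suc n)
        = (\<integral>\<^sup>+j. taboo (Suc n) j * (step_op h j + g j) \<partial>count_space UNIV)"
      unfolding G_def by (simp add: distrib_left nn_integral_add)
    also have "\<dots> \<le> A (Suc n)"
      unfolding A_def
    proof (rule nn_integral_mono)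
      fix j show "taboo (Suc n) j * (step_op h j + g j) \<le> taboo (Suc n) j * h j"
        by (cases "j = i") (auto simp: taboo_Suc intro!: mult_left_mono h)
    qed
    finally show ?thesis unfolding push .
  qed
  have partial: "A (Suc N) + (\<Sum>n<Suc N. first_return n * h i) + (\<Sum>n<N. G (Suc n)) \<le> step_op h i" for N
  proof (induction N)
    case 0
    then show ?case using start by simp
  next
    case (Suc N)
    have "A (Suc (Suc N)) + (\<Sum>n<Suc (Suc N). first_return n * h i) + (\<Sum>n<Suc N. G (Suc n))
      = (A (Suc (Suc N)) + first_return (Suc N) * h i + G (Suc N))
        + ((\<Sum>n<Suc N. first_return n * h i) + (\<Sum>n<N. G (Suc n)))"
      by (simp add: add_ac)
    also have "\<dots> \<le> A (Suc N) + ((\<Sum>n<Suc N. first_return n * h i) + (\<Sum>n<N. G (Suc n)))"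
      by (intro add_right_mono step)
    also have "\<dots> \<le> step_op h i"
      using Suc by (simp only: add.assoc)
    finally show ?case .
  qed
  have "(\<Sum>n<N. first_return n * h i + G (Suc n)) \<le> step_op h i" for N
  proof -
    have "(\<Sum>n<N. first_return n * h i + G (Suc n))
      \<le> A (Suc N) + (\<Sum>n<Suc N. first_return n * h i) + (\<Sum>n<N. G (Suc n))"
      by (simp add: sum.distrib add_increasing add_increasing2 add_ac)
    then show ?thesis using partial[of N] by (rule order_trans)
  qed
  then have "(\<Sum>n. first_return n * h i + G (Suc n)) \<le> step_op h i"
    by (intro suminf_le_const summableI)
  moreover have "(\<Sum>n. first_return n * h i + G (Suc n)) = (\<Sum>n. first_return n * h i) + (\<Sum>n. G (Suc n))"
    by (rule suminf_add[symmetric]) (rule summableI)+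
  moreover have "(\<Sum>n. first_return n * h i) = h i"
    by (simp add: suminf_first_return)
  moreover have "(\<Sum>n. G (Suc n)) = (\<integral>\<^sup>+j. (if j = i then 0 else occupation j * g j) \<partial>count_space UNIV)"
  proof -
    have "(\<Sum>n. G (Suc n)) = (\<integral>\<^sup>+j. (\<Sum>n. taboo (Suc n) j * g j) \<partial>count_space UNIV)"
      unfolding G_def by (rule nn_integral_suminf[symmetric]) simp
    also have "\<dots> = (\<integral>\<^sup>+j. (if j = i then 0 else occupation j * g j) \<partial>count_space UNIV)"
      by (intro nn_integral_cong) (simp add: occupation_off_start, simp add: taboo_Suc)
    finally show ?thesis .
  qed
  ultimately show ?thesis by simp
qed

text \<open>With \<open>g\<close> the full defect, \<open>excursion_inequality\<close> bounds
  \<open>h i\<close> plus the weighted defect by \<open>step_op h i\<close>, which is at most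
  \<open>h i\<close> again. As \<open>h i\<close> is finite, the weighted defect is zero, and the
  weights \<open>occupation j\<close> are positive.\<close>

lemma superharmonic_imp_harmonic:
  assumes super: "\<And>j. step_op h j \<le> h j" and fin: "\<And>j. h j \<noteq> \<top>"
  shows "step_op h j = h j"
proof -
  define g where "g j = h j - step_op h j" for j
  have split: "step_op h j + g j = h j" for j
    unfolding g_def using super[of j] by (simp add: add_diff_inverse_ennreal)
  let ?I = "\<integral>\<^sup>+j. (if j = i then 0 else occupation j * g j) \<partial>count_space UNIV"
  have ineq: "h i + ?I \<le> step_op h i"
    by (rule excursion_inequality) (simp add: split)
  have "h i + ?I \<le> h i + 0" using order_trans[OF ineq super[of i]] by (simp only: add_0_right)
  then have "?I = 0" using fin[of i] by (simp only: ennreal_add_left_cancel_le) simp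
  then have zero: "occupation j * g j = 0" if "j \<noteq> i" for j
    using spec[OF \<open>?I = 0\<close>[unfolded nn_integral_count_space_eq_0_iff], of j] that by simp
  show ?thesis
  proof (cases "j = i")
    case True
    then show ?thesis using ineq super[of i] \<open>?I = 0\<close> by simp
  next
    case False
    have "occupation j \<noteq> 0"
      using occupation_eq[of j] m_pos[of j] by (intro notI) (simp add: ennreal_eq_0_iff)
    then have "g j = 0" using zero[OF False] by simp
    then show ?thesis using split[of j] by simp
  qed
qed

text \<open>Truncating at \<open>c = h j\<close> keeps the function superharmonic, hence harmonic,
  and makes \<open>j\<close> a point of maximum. An average over the successors of \<open>j\<close>
  equals this maximum only if each of them attains it, so \<open>h\<close> cannot decrease along a
  positive step. Irreducibility gives both inequalities between any two states.\<close>

lemma superharmonic_imp_const: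
  assumes super: "\<And>j. step_op h j \<le> h j" and fin: "\<And>j. h j \<noteq> \<top>"
  shows "h j = h k"
proof -
  have step: "h j \<le> h k" if "0 < p j k" for j k
  proof -
    define c where "c = h j"
    define h' where "h' k = min (h k) c" for k
    have c: "c \<noteq> \<top>" unfolding c_def by (rule fin)
    have "step_op h' l \<le> h' l" for l
    proof -
      have "step_op h' l \<le> step_op h l" "step_op h' l \<le> step_op (\<lambda>_. c) l"
        by (auto intro!: step_op_mono simp: h'_def)
      then show ?thesis using super[of l] unfolding h'_def step_op_const by auto
    qed
    moreover have "h' l \<noteq> \<top>" for l using fin[of l] c unfolding h'_def by (simp add: min_def)
    ultimately have "step_op h' j = h' j" by (rule superharmonic_imp_harmonic)
    then have harm: "step_op h' j = c" unfolding h'_def c_def by simp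
    have "step_op (\<lambda>k. h' k + (c - h' k)) j = step_op (\<lambda>_. c) j"
    proof -
      have "h' k + (c - h' k) = c" for k
        by (rule add_diff_inverse_ennreal) (simp add: h'_def)
      then show ?thesis by (simp only:)
    qed
    then have "c + step_op (\<lambda>k. c - h' k) j = c + 0"
      unfolding step_op_add harm step_op_const by simp
    then have "step_op (\<lambda>k. c - h' k) j = 0"
      using c by (simp only: ennreal_add_left_cancel) simp
    then have "ennreal (p j k) * (c - h' k) = 0"
      unfolding step_op_def by (simp only: nn_integral_count_space_eq_0_iff)
    then have "c - h' k = 0" using that by simp
    then have "c \<le> h' k" using c by (simp add: diff_eq_0_iff_ennreal)
    then show ?thesis unfolding h'_def c_def by simp
  qed
  have "h j \<le> h k" for j k
    by (rule irreducible_backward_induct[where Q="\<lambda>j. h j \<le> h k" and k=k, OF irreducible p_nonneg])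
       (use step order_trans in blast)+
  then show ?thesis by (intro antisym)
qed

end

section \<open>Finiteness of the stopping time\<close>

text \<open>For \<open>l \<le> w\<close> truncated subtraction gives \<open>a 0 = 1\<close>, so the
  shift trades the last \<open>w\<close> terms for \<open>w\<close> ones. The length
  \<open>2 * n\<close> ensures for \<open>w \<le> n\<close> that those last terms have index above
  \<open>n\<close> and are at most \<open>a n\<close>. For larger \<open>w\<close> monotonicity
  suffices.\<close>

lemma sum_shifted_antimono_ge:
  fixes a :: "nat \<Rightarrow> ennreal"
  assumes a: "\<And>k l. k \<le> l \<Longrightarrow> a l \<le> a k" and a0: "a 0 = 1"
  shows "(\<Sum>l=1..2*n. a l) + (if w \<le> n then of_nat w * (1 - a n) else 0) \<le> (\<Sum>l=1..2*n. a (l - w))"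
proof (cases "w \<le> n")
  case True
  define b where "b = 2 * n - w"
  have b: "2 * n = w + b" "n \<le> b" using True unfolding b_def by auto
  have "(\<Sum>l=1..2*n. a (l - w)) = (\<Sum>l=1..w. a (l - w)) + (\<Sum>l=w+1..w+b. a (l - w))"
    unfolding b by (rule sum.ub_add_nat) simp
  also have "(\<Sum>l=1..w. a (l - w)) = of_nat w" using a0 by simp
  also have "(\<Sum>l=w+1..w+b. a (l - w)) = (\<Sum>l=1..b. a l)"
    using sum.shift_bounds_cl_nat_ivl[of "\<lambda>l. a (l - w)" 1 w b] by (simp add: add.commute)
  finally have R: "(\<Sum>l=1..2*n. a (l - w)) = of_nat w + (\<Sum>l=1..b. a l)" .
  have "(\<Sum>l=1..2*n. a l) = (\<Sum>l=1..b. a l) + (\<Sum>l=b+1..b+w. a l)"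
    unfolding b by (subst add.commute[of w]) (rule sum.ub_add_nat, simp)
  also have "(\<Sum>l=b+1..b+w. a l) \<le> (\<Sum>l=b+1..b+w. a n)"
    by (rule sum_mono) (use a b(2) in auto)
  also have "(\<Sum>l=b+1..b+w. a n) = of_nat w * a n" by simp
  finally have L: "(\<Sum>l=1..2*n. a l) \<le> (\<Sum>l=1..b. a l) + of_nat w * a n" by simp
  have "(\<Sum>l=1..2*n. a l) + of_nat w * (1 - a n)
      \<le> ((\<Sum>l=1..b. a l) + of_nat w * a n) + of_nat w * (1 - a n)"
    by (rule add_right_mono[OF L])
  also have "\<dots> = (\<Sum>l=1..b. a l) + of_nat w * (a n + (1 - a n))"
    by (simp add: distrib_left add.assoc)
  also have "a n + (1 - a n) = 1"
    using a[of 0 n] a0 by (simp add: add_diff_inverse_ennreal)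
  finally show ?thesis using True R by (simp add: add.commute)
next
  case False
  then show ?thesis by (auto intro!: sum_mono a)
qed

locale shift_setting = recurrent_two_sided_chain M p m i X
  for M :: "'w measure" and p :: "('s::countable) matrix" and m :: "'s \<Rightarrow> real" and i :: 's
    and X :: "int \<Rightarrow> 'w \<Rightarrow> 's" +
  fixes \<nu> :: "'s pmf"
  assumes no_mass_at_start: "pmf \<nu> i = 0"
    and integral: "\<And>j. m i / m j * pmf \<nu> j \<in> \<int>"
begin

section \<open>Integer weights and the increment walk\<close>

definition weight :: "'s \<Rightarrow> nat" where
  "weight j = nat \<lfloor>m i / m j * pmf \<nu> j\<rfloor>"

lemma of_nat_weight: "real (weight j) = m i / m j * pmf \<nu> j"
proof -
  have "0 \<le> m i / m j * pmf \<nu> j"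
    using m_pos by (simp add: less_imp_le)
  moreover obtain z where z: "m i / m j * pmf \<nu> j = of_int z"
    using integral[of j] by (elim Ints_cases)
  ultimately show ?thesis unfolding weight_def by simp
qed

lemma weight_start: "weight i = 0"
  unfolding weight_def using no_mass_at_start by simp

text \<open>This is the expected gain collected at \<open>j\<close> during one excursion; summed
  over \<open>j\<close> it balances the unit lost at \<open>i\<close>.\<close>

lemma occupation_weight: "occupation j * of_nat (weight j) = ennreal (pmf \<nu> j)"
proof -
  have pos: "0 < m i" "0 < m j" by (rule m_pos)+
  have "ennreal (m i) * (occupation j * of_nat (weight j)) = ennreal (m j) * of_nat (weight j)"
    by (simp only: occupation_eq mult.assoc[symmetric])
  also have "\<dots> = ennreal (m j * real (weight j))"
    using pos by (simp add: ennreal_mult' ennreal_of_nat_eq_real_of_nat)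
  also have "m j * real (weight j) = m i * pmf \<nu> j"
    unfolding of_nat_weight using pos by simp
  finally have "ennreal (m i) * (occupation j * of_nat (weight j)) = ennreal (m i) * ennreal (pmf \<nu> j)"
    using pos by (simp add: ennreal_mult')
  then show ?thesis
    using pos(1) by (subst (asm) ennreal_mult_cancel_left) (auto simp: ennreal_eq_0_iff)
qed

definition incr :: "'s \<Rightarrow> int" where
  "incr j = int (weight j) - of_bool (j = i)"

text \<open>
  \<open>hit_prob n l j\<close> is the probability that, starting in \<open>j\<close>, one of the first \<open>n\<close> partial sums
  of the increments (including that of \<open>j\<close> itself) reaches level \<open>l\<close>; truncated subtraction
  is harmless here because level \<open>0\<close> counts as reached.
\<close>
primrec hit_prob :: "nat \<Rightarrow> nat \<Rightarrow> 's \<Rightarrow> ennreal" where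
  "hit_prob 0 = (\<lambda>l j. of_bool (l = 0))"
| "hit_prob (Suc n) = (\<lambda>l j. if l = 0 then 1
     else step_op (hit_prob n (if j = i then Suc l else l - weight j)) j)"

lemma hit_prob_le_1: "hit_prob n l j \<le> 1"
proof (induction n arbitrary: l j)
  case (Suc n)
  have "step_op (hit_prob n l') j \<le> step_op (\<lambda>_. 1) j" for l'
    by (rule step_op_mono[OF Suc])
  then show ?case by (simp add: step_op_const)
qed simp

lemma hit_prob_zero: "hit_prob n 0 j = 1"
  by (cases n) auto

lemma hit_prob_Suc_ge: "hit_prob n l j \<le> hit_prob (Suc n) l j"
proof (induction n arbitrary: l j)
  case (Suc n)
  have "step_op (hit_prob n l') j \<le> step_op (hit_prob (Suc n) l') j" for l'
    by (rule step_op_mono[OF Suc])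
  then show ?case
    by (simp only: hit_prob.simps(2)[of "Suc n"] hit_prob.simps(2)[of n] split: if_split) simp
qed (simp del: hit_prob.simps(2) add: hit_prob_zero)

lemma hit_prob_antimono: "l \<le> l' \<Longrightarrow> hit_prob n l' j \<le> hit_prob n l j"
proof (induction n arbitrary: l l' j)
  case (Suc n)
  show ?case
  proof (cases "l = 0")
    case True
    then show ?thesis by (simp only: hit_prob_zero hit_prob_le_1)
  next
    case False
    then show ?thesis using Suc.prems by (auto intro!: step_op_mono Suc.IH)
  qed
qed simp

section \<open>Level-hitting functions and their limit at high levels\<close>

definition hit :: "nat \<Rightarrow> 's \<Rightarrow> ennreal" where
  "hit l j = (SUP n. hit_prob n l j)"

lemma hit_le_1: "hit l j \<le> 1"
  unfolding hit_def by (rule SUP_least) (rule hit_prob_le_1)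

lemma hit_zero: "hit 0 j = 1"
  unfolding hit_def by (simp add: hit_prob_zero)

lemma hit_antimono: "l \<le> l' \<Longrightarrow> hit l' j \<le> hit l j"
  unfolding hit_def by (rule SUP_mono) (auto intro: hit_prob_antimono)

lemma step_op_hit: "step_op (hit l) j = (SUP n. step_op (hit_prob n l) j)"
proof -
  have "step_op (hit l) j = (\<integral>\<^sup>+k. (SUP n. ennreal (p j k) * hit_prob n l k) \<partial>count_space UNIV)"
    unfolding step_op_def hit_def by (simp add: SUP_mult_left_ennreal)
  also have "\<dots> = (SUP n. step_op (hit_prob n l) j)"
    unfolding step_op_def
    by (rule nn_integral_monotone_convergence_SUP)
       (auto intro!: incseq_SucI le_funI mult_left_mono hit_prob_Suc_ge simp del: hit_prob.simps)
  finally show ?thesis .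
qed

lemma hit_step:
  assumes "l \<noteq> 0"
  shows "hit l j = step_op (hit (if j = i then Suc l else l - weight j)) j"
proof -
  have "hit l j = (SUP n. hit_prob (Suc n) l j)"
    unfolding hit_def
    by (intro antisym SUP_mono) (use hit_prob_Suc_ge in blast)+
  then show ?thesis using assms unfolding step_op_hit by simp
qed

lemma step_op_hit_antimono: "l \<le> l' \<Longrightarrow> step_op (hit l') j \<le> step_op (hit l) j"
  by (intro step_op_mono hit_antimono)

definition hit_limit :: ennreal where
  "hit_limit = (INF l. hit l i)"

text \<open>The functions decrease in the level, so they converge pointwise to an infimum
  \<open>s\<close>. A step only changes the level, and \<open>s\<close> lies below every level, so
  \<open>s\<close> is superharmonic; being bounded, it does not depend on \<open>j\<close>.\<close>

lemma hit_LIMSEQ: "(\<lambda>l. hit l j) \<longlonglongrightarrow> hit_limit"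
proof -
  define s where "s j = (INF l. hit l j)" for j
  have lim: "(\<lambda>l. hit l j) \<longlonglongrightarrow> s j" for j
    unfolding s_def by (intro LIMSEQ_INF decseq_SucI hit_antimono) simp
  have s_le: "s j \<le> hit l j" for j l unfolding s_def by (rule INF_lower) simp
  have "step_op s j \<le> s j" for j
    unfolding s_def[of j]
  proof (rule INF_greatest)
    fix l
    show "step_op s j \<le> hit l j"
    proof (cases "l = 0")
      case True
      have "step_op s j \<le> step_op (\<lambda>_. 1) j"
        by (rule step_op_mono) (use s_le hit_le_1 order_trans in blast)
      then show ?thesis using True by (simp add: hit_zero step_op_const)
    next
      case False
      show ?thesis by (subst hit_step[OF False]) (rule step_op_mono, rule s_le)
    qed
  qed
  moreover have "s j \<noteq> \<top>" for j
    using order_trans[OF s_le[of j 0] hit_le_1] by (auto simp: top_unique)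
  ultimately have "s j = s i" by (rule superharmonic_imp_const)
  then show ?thesis using lim[of j] by (simp add: hit_limit_def s_def[of i])
qed

lemma hit_limit_le: "hit_limit \<le> hit l i"
  unfolding hit_limit_def by (rule INF_lower) simp

lemma step_op_sum: "step_op (\<lambda>k. \<Sum>l\<in>I. f l k) j = (\<Sum>l\<in>I. step_op (f l) j)"
  unfolding step_op_def by (simp add: sum_distrib_left nn_integral_sum)

text \<open>The test function sums \<open>hit l\<close> over the levels 1 to \<open>2 * n\<close>.
  Away from \<open>i\<close> a step lowers the level by \<open>weight j\<close>, and
  \<open>sum_shifted_antimono_ge\<close> bounds the defect from below. At \<open>i\<close> the level
  rises by one, so the two sides of the excursion inequality share all but their extreme
  levels.\<close>

lemma excursion_hit_inequality:
  assumes "1 \<le> n"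
  shows "hit_limit + (\<integral>\<^sup>+j. (if j = i then 0 else
      occupation j * (if weight j \<le> n then of_nat (weight j) * (1 - step_op (hit n) j) else 0))
      \<partial>count_space UNIV) \<le> step_op (hit 1) i"
    (is "_ + ?I \<le> _")
proof -
  let ?P = "\<lambda>l. step_op (hit l) i"
  define h where "h j = (\<Sum>l=1..2*n. hit l j)" for j
  have sh: "step_op h j = (\<Sum>l=1..2*n. step_op (hit l) j)" for j
    unfolding h_def by (rule step_op_sum)
  have "h i + ?I \<le> step_op h i"
  proof (rule excursion_inequality)
    fix j assume "j \<noteq> i"
    have "h j = (\<Sum>l=1..2*n. step_op (hit (l - weight j)) j)"
      unfolding h_def by (rule sum.cong) (use hit_step \<open>j \<noteq> i\<close> in auto)
    moreover have "step_op (hit 0) j = 1"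
      using step_op_const[of 1 j] hit_zero by (simp add: step_op_def)
    ultimately show "step_op h j + (if weight j \<le> n then of_nat (weight j) * (1 - step_op (hit n) j) else 0) \<le> h j"
      unfolding sh using sum_shifted_antimono_ge[of "\<lambda>l. step_op (hit l) j" n "weight j"]
        step_op_hit_antimono by simp
  qed
  moreover have "h i = (\<Sum>l=1..2*n. ?P (Suc l))"
    unfolding h_def by (rule sum.cong) (use hit_step[of _ i] in auto)
  moreover have "(\<Sum>l=1..2*n. ?P (Suc l)) = (\<Sum>l=2..2*n. ?P l) + ?P (Suc (2*n))"
    using assms sum.shift_bounds_cl_Suc_ivl[of ?P 1 "2*n"]
    by (simp add: numeral_2_eq_2)
  moreover have "(\<Sum>l=1..2*n. ?P l) = ?P 1 + (\<Sum>l=2..2*n. ?P l)"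
    using assms by (subst sum.atLeast_Suc_atMost) (auto simp: numeral_2_eq_2)
  \<comment> \<open>The shared levels 2 to \<open>2 * n\<close> have a finite sum and cancel; level
    1 and level \<open>Suc (2 * n)\<close> remain.\<close>
  ultimately have "(\<Sum>l=2..2*n. ?P l) + (?P (Suc (2*n)) + ?I) \<le> (\<Sum>l=2..2*n. ?P l) + ?P 1"
    unfolding sh by (simp only: add.assoc add.commute[of "?P 1"])
  moreover have "(\<Sum>l=2..2*n. ?P l) \<noteq> \<top>"
  proof -
    have "?P l \<le> 1" for l
      using step_op_mono[of "hit l" "\<lambda>_. 1" i] by (simp add: hit_le_1 step_op_const)
    then have "?P l \<noteq> \<top>" for l by (metis ennreal_one_neq_top neq_top_trans)
    then show ?thesis by simp
  qed
  ultimately have "?P (Suc (2*n)) + ?I \<le> ?P 1"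
    by (simp only: ennreal_add_left_cancel_le) simp
  moreover have "hit_limit \<le> ?P (Suc (2*n))"
    using hit_limit_le[of "2*n"] hit_step[of "2*n" i] assms by simp
  ultimately show ?thesis by (rule order_trans[OF add_right_mono, rotated])
qed

text \<open>After the unit is paid at \<open>i\<close>, the increments that follow reach level 1
  with full probability. As the cut-off grows, the defect term increases to
  \<open>1 - hit_limit\<close>, because the masses \<open>pmf \<nu> j\<close> sum to one; added to
  \<open>hit_limit\<close> this gives one, whatever the value of \<open>hit_limit\<close>.\<close>

lemma step_op_hit_1: "1 \<le> step_op (hit 1) i"
proof -
  define G where "G n j = (if j = i then 0 else
      occupation j * (if weight j \<le> n then of_nat (weight j) * (1 - step_op (hit n) j) else 0))"
    for n j
  have P_le: "step_op (hit n) j \<le> 1" for n j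
    using step_op_mono[of "hit n" "\<lambda>_. 1" j] by (simp add: hit_le_1 step_op_const)
  have lim_le: "hit_limit \<le> 1" using hit_limit_le[of 0] by (simp add: hit_zero)
  have lim: "(\<lambda>n. G n j) \<longlonglongrightarrow> (1 - hit_limit) * ennreal (pmf \<nu> j)" for j
  proof (cases "j = i")
    case True
    then show ?thesis by (simp add: G_def no_mass_at_start)
  next
    case False
    \<comment> \<open>The recursion is read in reverse: level \<open>n\<close> to be reached after
      leaving \<open>j \<noteq> i\<close> is level \<open>n + weight j\<close> before the increment
      of \<open>j\<close> is counted.\<close>
    have eq: "step_op (hit n) j = hit (n + Suc (weight j) - 1) j" if "1 \<le> n" for n
      using hit_step[of "n + weight j" j] that False by simp
    have "(\<lambda>n. hit (n + weight j) j) \<longlonglongrightarrow> hit_limit"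
      by (rule LIMSEQ_ignore_initial_segment[OF hit_LIMSEQ])
    moreover have "eventually (\<lambda>n. hit (n + weight j) j = step_op (hit n) j) sequentially"
      using eventually_ge_at_top[of 1] by eventually_elim (simp add: eq)
    ultimately have "(\<lambda>n. step_op (hit n) j) \<longlonglongrightarrow> hit_limit"
      by (rule Lim_transform_eventually)
    then have "(\<lambda>n. 1 - step_op (hit n) j) \<longlonglongrightarrow> 1 - hit_limit"
      using lim_le by (intro tendsto_diff_ennreal tendsto_const) (auto simp: top_unique)
    then have "(\<lambda>n. ennreal (pmf \<nu> j) * (1 - step_op (hit n) j)) \<longlonglongrightarrow> ennreal (pmf \<nu> j) * (1 - hit_limit)"
      by (rule ennreal_tendsto_cmult[rotated]) simp
    moreover have "eventually (\<lambda>n. ennreal (pmf \<nu> j) * (1 - step_op (hit n) j) = G n j) sequentially"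
      using eventually_ge_at_top[of "weight j"]
      by eventually_elim (simp add: G_def False occupation_weight[symmetric] mult.assoc)
    ultimately show ?thesis
      by (subst mult.commute) (rule Lim_transform_eventually)
  qed
  have inc: "incseq G"
  proof (intro incseq_SucI le_funI)
    fix n j
    have "1 - step_op (hit n) j \<le> 1 - step_op (hit (Suc n)) j"
      by (intro ennreal_minus_mono step_op_hit_antimono) simp_all
    then show "G n j \<le> G (Suc n) j" unfolding G_def by (auto intro!: mult_left_mono)
  qed
  have "(\<lambda>n. \<integral>\<^sup>+j. G n j \<partial>count_space UNIV)
      \<longlonglongrightarrow> (\<integral>\<^sup>+j. (1 - hit_limit) * ennreal (pmf \<nu> j) \<partial>count_space UNIV)"
    by (rule nn_integral_LIMSEQ[OF inc _ lim]) simp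
  also have "(\<integral>\<^sup>+j. (1 - hit_limit) * ennreal (pmf \<nu> j) \<partial>count_space UNIV) = 1 - hit_limit"
    by (simp add: nn_integral_cmult nn_integral_pmf measure_pmf.emeasure_space_1[simplified])
  finally have "(\<lambda>n. hit_limit + (\<integral>\<^sup>+j. G n j \<partial>count_space UNIV)) \<longlonglongrightarrow> hit_limit + (1 - hit_limit)"
    by (intro tendsto_add tendsto_const)
  then have "hit_limit + (1 - hit_limit) \<le> step_op (hit 1) i"
    by (rule LIMSEQ_le_const2)
       (use excursion_hit_inequality in \<open>auto simp: G_def intro!: exI[of _ 1]\<close>)
  then show ?thesis using lim_le by (simp add: add_diff_inverse_ennreal)
qed

section \<open>Hitting functions as path probabilities\<close>

definition hits :: "nat \<Rightarrow> nat \<Rightarrow> nat \<Rightarrow> 'w \<Rightarrow> bool" where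
  "hits a n l \<omega> \<longleftrightarrow> l = 0 \<or> (\<exists>k<n. int l \<le> (\<Sum>b=int a..int a + int k. incr (X b \<omega>)))"

lemma hits_cong:
  assumes "\<And>b. int a \<le> b \<Longrightarrow> b < int a + int n \<Longrightarrow> X b \<omega> = X b \<omega>'" and "hits a n l \<omega>"
  shows "hits a n l \<omega>'"
proof -
  have "(\<Sum>b=int a..int a + int k. incr (X b \<omega>)) = (\<Sum>b=int a..int a + int k. incr (X b \<omega>'))" if "k < n" for k
    by (rule sum.cong) (use assms(1) that in auto)
  then show ?thesis using assms(2) unfolding hits_def by metis
qed

lemma hits_Suc:
  assumes "X (int a) \<omega> = j" "l \<noteq> 0"
  shows "hits a (Suc n) l \<omega> \<longleftrightarrow> hits (Suc a) n (if j = i then Suc l else l - weight j) \<omega>"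
proof -
  have split: "(\<Sum>b=int a..int a + int (Suc k). incr (X b \<omega>))
      = incr j + (\<Sum>b=int (Suc a)..int (Suc a) + int k. incr (X b \<omega>))" for k
  proof -
    have "{int a..int a + int (Suc k)} = insert (int a) {int (Suc a)..int (Suc a) + int k}" by auto
    then show ?thesis using assms(1) by simp
  qed
  have first: "(\<Sum>b=int a..int a + int 0. incr (X b \<omega>)) = incr j" using assms(1) by simp
  have ex: "(\<exists>k<Suc n. Q k) \<longleftrightarrow> Q 0 \<or> (\<exists>k<n. Q (Suc k))" for Q :: "nat \<Rightarrow> bool"
    using less_Suc_eq_0_disj by auto
  have "hits a (Suc n) l \<omega> \<longleftrightarrow> int l \<le> incr j
      \<or> (\<exists>k<n. int l \<le> incr j + (\<Sum>b=int (Suc a)..int (Suc a) + int k. incr (X b \<omega>)))"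
    unfolding hits_def ex first split using assms(2) by simp
  also have "\<dots> \<longleftrightarrow> hits (Suc a) n (if j = i then Suc l else l - weight j) \<omega>"
  proof (cases "j = i")
    case True
    then have "incr j = -1" unfolding incr_def by (simp add: weight_start)
    moreover have "int l \<le> -1 + x \<longleftrightarrow> int (Suc l) \<le> x" for x by auto
    ultimately show ?thesis using True unfolding hits_def by simp
  next
    case False
    then have j: "incr j = int (weight j)" unfolding incr_def by simp
    show ?thesis
    proof (cases "l \<le> weight j")
      \<comment> \<open>The first increment alone reaches \<open>l\<close>; on the other side the
        truncated difference is 0, a level that counts as reached.\<close>
      case True
      then show ?thesis using False j unfolding hits_def by simp
    next
      case l: False
      then have "int l \<le> int (weight j) + x \<longleftrightarrow> int (l - weight j) \<le> x" for x by auto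
      then show ?thesis using False j l unfolding hits_def by simp
    qed
  qed
  finally show ?thesis .
qed

text \<open>The induction moves the starting time \<open>a\<close>, so the conditioning event
  \<open>A\<close> has to be arbitrary: after one step it also records the state at the old time
  \<open>a\<close>.\<close>

lemma emeasure_hits:
  assumes "determined 0 a A"
  shows "emeasure M {\<omega>\<in>{\<omega>\<in>A. X (int a) \<omega> = j}. hits a n l \<omega>}
    = emeasure M {\<omega>\<in>A. X (int a) \<omega> = j} * hit_prob n l j"
  using assms
proof (induction n arbitrary: A a j l)
  case 0
  then show ?case by (simp add: hits_def)
next
  case (Suc n)
  show ?case
  proof (cases "l = 0")
    case True
    then show ?thesis by (simp add: hits_def)
  next
    case False
    define l' where "l' = (if j = i then Suc l else l - weight j)"
    define A' where "A' = {\<omega>\<in>A. X (int a) \<omega> = j}"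
    have A': "determined 0 a A'"
      unfolding A'_def by (rule determined_Collect[OF Suc.prems]) simp
    have A'2: "determined 0 (Suc a) A'" by (rule determined_mono[OF A']) auto
    have eq: "{\<omega>\<in>{\<omega>\<in>A. X (int a) \<omega> = j}. hits a (Suc n) l \<omega>} = {\<omega>\<in>A'. hits (Suc a) n l' \<omega>}"
      unfolding A'_def l'_def using hits_Suc[OF _ False] by auto
    have "determined 0 (Suc a + n) {\<omega>\<in>A'. hits (Suc a) n l' \<omega>}"
    proof (rule determined_Collect)
      show "determined 0 (Suc a + n) A'" by (rule determined_mono[OF A']) auto
      fix \<omega> \<omega>' assume eq: "\<And>k. - int 0 \<le> k \<Longrightarrow> k \<le> int (Suc a + n) \<Longrightarrow> X k \<omega> = X k \<omega>'"
        and H: "hits (Suc a) n l' \<omega>"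
      show "hits (Suc a) n l' \<omega>'" by (rule hits_cong[OF eq H]) simp_all
    qed
    then have S: "{\<omega>\<in>A'. hits (Suc a) n l' \<omega>} \<in> sets M" by (rule determined_sets)
    have "emeasure M {\<omega>\<in>A'. hits (Suc a) n l' \<omega>}
        = emeasure M {\<omega>\<in>{\<omega>\<in>A'. hits (Suc a) n l' \<omega>}. X (int (Suc a)) \<omega> \<in> UNIV}" by simp
    also have "\<dots> = (\<integral>\<^sup>+k. emeasure M {\<omega>\<in>{\<omega>\<in>A'. hits (Suc a) n l' \<omega>}. X (int (Suc a)) \<omega> = k} \<partial>count_space UNIV)"
      by (rule countable_fibre_sum[OF X_measurable S])
    also have "\<dots> = (\<integral>\<^sup>+k. emeasure M A' * (ennreal (p j k) * hit_prob n l' k) \<partial>count_space UNIV)"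
    proof (rule nn_integral_cong)
      fix k
      have "{\<omega>\<in>{\<omega>\<in>A'. hits (Suc a) n l' \<omega>}. X (int (Suc a)) \<omega> = k}
        = {\<omega>\<in>{\<omega>\<in>A'. X (int (Suc a)) \<omega> = k}. hits (Suc a) n l' \<omega>}"
        by (simp only: mem_Collect_eq conj_ac)
      then have "emeasure M {\<omega>\<in>{\<omega>\<in>A'. hits (Suc a) n l' \<omega>}. X (int (Suc a)) \<omega> = k}
        = emeasure M {\<omega>\<in>A'. X (int (Suc a)) \<omega> = k} * hit_prob n l' k"
        by (simp only: Suc.IH[OF A'2])
      also have "{\<omega>\<in>A'. X (int (Suc a)) \<omega> = k} = {\<omega>\<in>A. X (int a) \<omega> = j \<and> X (int (Suc a)) \<omega> = k}"
        unfolding A'_def by (simp only: mem_Collect_eq conj_ac)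
      also have "emeasure M \<dots> = emeasure M A' * ennreal (p j k)"
        unfolding A'_def by (rule markov_step[OF Suc.prems])
      finally show "emeasure M {\<omega>\<in>{\<omega>\<in>A'. hits (Suc a) n l' \<omega>}. X (int (Suc a)) \<omega> = k}
        = emeasure M A' * (ennreal (p j k) * hit_prob n l' k)" by (simp only: mult.assoc)
    qed
    also have "\<dots> = emeasure M A' * step_op (hit_prob n l') j"
      unfolding step_op_def by (simp add: nn_integral_cmult)
    finally show ?thesis
      unfolding eq using False by (simp add: l'_def A'_def)
  qed
qed

definition partial_sum :: "nat \<Rightarrow> 'w \<Rightarrow> int" where
  "partial_sum n \<omega> = (\<Sum>b=0..int n. incr (X b \<omega>))"

lemma determined_partial_sum: "determined 0 n {\<omega>\<in>space M. Q (partial_sum n \<omega>)}"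
proof (rule determinedI)
  fix \<omega> \<omega>' assume eq: "\<And>k. - int 0 \<le> k \<Longrightarrow> k \<le> int n \<Longrightarrow> X k \<omega> = X k \<omega>'"
    and Q: "Q (partial_sum n \<omega>)"
  have "incr (X b \<omega>) = incr (X b \<omega>')" if "b \<in> {0..int n}" for b
    by (rule arg_cong[OF eq]) (use that in simp_all)
  then have "partial_sum n \<omega> = partial_sum n \<omega>'"
    unfolding partial_sum_def by (rule sum.cong[OF refl])
  with Q show "Q (partial_sum n \<omega>')" by simp
qed

text \<open>Time 0 contributes \<open>incr i = -1\<close>, so it suffices that the increments from
  time 1 on reach level 1. The finite-horizon probabilities of this have supremum
  \<open>step_op (hit 1) i\<close>, which is at least one.\<close>

lemma AE_partial_sum_nonneg: "AE \<omega> in M. \<exists>n. 0 \<le> partial_sum n \<omega>"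
proof -
  let ?E = "{\<omega>\<in>space M. \<exists>n. 0 \<le> partial_sum n \<omega>}"
  have "(\<Union>n. {\<omega>\<in>space M. 0 \<le> partial_sum n \<omega>}) \<in> sets M"
    by (intro sets.countable_UN) (auto intro!: determined_sets[OF determined_partial_sum])
  also have "(\<Union>n. {\<omega>\<in>space M. 0 \<le> partial_sum n \<omega>}) = ?E" by auto
  finally have E: "?E \<in> sets M" .
  have "step_op (hit_prob n 1) i \<le> emeasure M ?E" for n
  proof -
    define A where "A = {\<omega>\<in>space M. X 0 \<omega> = i}"
    have A0: "determined 0 0 A" unfolding A_def by (rule determinedI) simp
    have A1: "determined 0 1 A" by (rule determined_mono[OF A0]) auto
    have A_one: "emeasure M {\<omega>\<in>A. X 0 \<omega> = i} = 1"
    proof -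
      have "emeasure M {\<omega>\<in>A. X 0 \<omega> = i} = emeasure M (space M)"
        by (rule emeasure_eq_AE) (use AE_start determined_sets[OF A0] in \<open>auto simp: A_def\<close>)
      then show ?thesis by (simp add: emeasure_space_1)
    qed
    have "determined 0 (1 + n) {\<omega>\<in>A. hits 1 n 1 \<omega>}"
    proof (rule determined_Collect)
      show "determined 0 (1 + n) A" by (rule determined_mono[OF A0]) auto
      fix \<omega> \<omega>' assume eq: "\<And>k. - int 0 \<le> k \<Longrightarrow> k \<le> int (1 + n) \<Longrightarrow> X k \<omega> = X k \<omega>'"
        and H: "hits 1 n 1 \<omega>"
      show "hits 1 n 1 \<omega>'" by (rule hits_cong[OF eq H]) simp_all
    qed
    then have S: "{\<omega>\<in>A. hits 1 n 1 \<omega>} \<in> sets M" by (rule determined_sets)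
    have "step_op (hit_prob n 1) i = (\<integral>\<^sup>+k. emeasure M {\<omega>\<in>{\<omega>\<in>A. hits 1 n 1 \<omega>}. X 1 \<omega> = k} \<partial>count_space UNIV)"
      unfolding step_op_def
    proof (rule nn_integral_cong)
      fix k
      have "{\<omega>\<in>{\<omega>\<in>A. hits 1 n 1 \<omega>}. X 1 \<omega> = k} = {\<omega>\<in>{\<omega>\<in>A. X (int 1) \<omega> = k}. hits 1 n 1 \<omega>}"
        by auto
      also have "emeasure M \<dots> = emeasure M {\<omega>\<in>A. X (int 1) \<omega> = k} * hit_prob n 1 k"
        by (rule emeasure_hits[OF A1])
      also have "{\<omega>\<in>A. X (int 1) \<omega> = k} = {\<omega>\<in>A. X (int 0) \<omega> = i \<and> X (int (Suc 0)) \<omega> = k}"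
        unfolding A_def by auto
      also have "emeasure M \<dots> = ennreal (p i k)"
        unfolding markov_step[OF A0] using A_one by simp
      finally show "ennreal (p i k) * hit_prob n 1 k = emeasure M {\<omega>\<in>{\<omega>\<in>A. hits 1 n 1 \<omega>}. X 1 \<omega> = k}" ..
    qed
    also have "\<dots> = emeasure M {\<omega>\<in>{\<omega>\<in>A. hits 1 n 1 \<omega>}. X 1 \<omega> \<in> UNIV}"
      by (rule countable_fibre_sum[OF X_measurable S, symmetric])
    also have "\<dots> \<le> emeasure M ?E"
    proof (rule emeasure_mono[OF _ E], rule subsetI)
      fix \<omega> assume "\<omega> \<in> {\<omega>\<in>{\<omega>\<in>A. hits 1 n 1 \<omega>}. X 1 \<omega> \<in> UNIV}"
      then have \<omega>: "\<omega> \<in> space M" "X 0 \<omega> = i" "hits 1 n 1 \<omega>" unfolding A_def by auto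
      then obtain k where k: "1 \<le> (\<Sum>b=1..1 + int k. incr (X b \<omega>))" unfolding hits_def by auto
      have "{0..int (Suc k)} = insert 0 {1..1 + int k}" by auto
      then have "partial_sum (Suc k) \<omega> = incr i + (\<Sum>b=1..1 + int k. incr (X b \<omega>))"
        unfolding partial_sum_def using \<omega>(2) by simp
      then have "0 \<le> partial_sum (Suc k) \<omega>" using k by (simp add: incr_def weight_start)
      then show "\<omega> \<in> ?E" using \<omega>(1) by blast
    qed
    finally show ?thesis .
  qed
  then have "step_op (hit 1) i \<le> emeasure M ?E"
    unfolding step_op_hit by (rule SUP_least)
  then have "1 \<le> emeasure M ?E" using step_op_hit_1 by (rule order_trans[rotated])
  then have "prob ?E = 1"
    by (intro antisym) (simp_all add: emeasure_eq_measure)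
  then show ?thesis using E by (subst (asm) prob_Collect_eq_1) auto
qed

end

section \<open>The past seen from the stopping time\<close>

lemma INF_enat_eq_iff:
  "(INF n\<in>N. enat n) = enat k \<longleftrightarrow> k \<in> N \<and> (\<forall>n<k. n \<notin> N)"
proof (cases "N = {}")
  case True
  then show ?thesis by (simp add: top_enat_def)
next
  case False
  define j where "j = (LEAST n. n \<in> N)"
  obtain n where "n \<in> N" using False by blast
  then have j: "j \<in> N" unfolding j_def by (rule LeastI)
  have j_le: "j \<le> n" if "n \<in> N" for n unfolding j_def using that by (rule Least_le)
  have "(INF n\<in>N. enat n) = enat j"
    by (rule antisym) (auto intro: INF_lower[OF j] INF_greatest simp: j_le)
  moreover have "j = k \<longleftrightarrow> k \<in> N \<and> (\<forall>n<k. n \<notin> N)"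
  proof
    assume "j = k"
    then show "k \<in> N \<and> (\<forall>n<k. n \<notin> N)" using j j_le leD by blast
  next
    assume "k \<in> N \<and> (\<forall>n<k. n \<notin> N)"
    then have "j \<le> k" "\<not> j < k" using j j_le by blast+
    then show "j = k" by simp
  qed
  ultimately show ?thesis by simp
qed

lemma nn_integral_count_space_eq_imp_eq:
  fixes f g :: "'a::countable \<Rightarrow> ennreal"
  assumes le: "\<And>x. f x \<le> g x"
    and eq: "(\<integral>\<^sup>+x. f x \<partial>count_space UNIV) = (\<integral>\<^sup>+x. g x \<partial>count_space UNIV)"
    and fin: "(\<integral>\<^sup>+x. g x \<partial>count_space UNIV) \<noteq> \<top>"
  shows "f x = g x"
proof -
  have split: "f y + (g y - f y) = g y" for y
    using le[of y] by (simp add: add_diff_inverse_ennreal)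
  have "(\<integral>\<^sup>+y. f y \<partial>count_space UNIV) + (\<integral>\<^sup>+y. g y - f y \<partial>count_space UNIV)
      = (\<integral>\<^sup>+y. g y \<partial>count_space UNIV)"
    by (subst nn_integral_add[symmetric]) (simp_all add: split)
  then have "(\<integral>\<^sup>+y. g y \<partial>count_space UNIV) + (\<integral>\<^sup>+y. g y - f y \<partial>count_space UNIV)
      = (\<integral>\<^sup>+y. g y \<partial>count_space UNIV) + 0"
    unfolding eq by simp
  then have "(\<integral>\<^sup>+y. g y - f y \<partial>count_space UNIV) = 0"
    using fin by (simp only: ennreal_add_left_cancel) simp
  then have "g x - f x = 0" by (simp only: nn_integral_count_space_eq_0_iff)
  then show ?thesis using split[of x] by simp
qed

context shift_setting
begin

section \<open>The stopping time as a first passage time\<close>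

definition path_sum :: "(int \<Rightarrow> 's) \<Rightarrow> nat \<Rightarrow> int" where
  "path_sum x n = (\<Sum>b=0..int n. incr (x b))"

text \<open>Multiplication by \<open>m i\<close> turns both sides into integers: a visit to
  \<open>j\<close> counts \<open>weight j\<close> on the right, a visit to \<open>i\<close> counts
  one on the left. The infinite sum reduces to the states in the finite image of the time
  interval.\<close>

lemma local_time_le_iff:
  "local_time m x i {0..int n} \<le> (\<Sum>\<^sub>\<infinity>j. pmf \<nu> j * local_time m x j {0..int n})
    \<longleftrightarrow> 0 \<le> path_sum x n"
proof -
  let ?A = "{0..int n}"
  have mi: "0 < m i" by (rule m_pos)
  have "(\<Sum>\<^sub>\<infinity>j. pmf \<nu> j * local_time m x j ?A) = (\<Sum>\<^sub>\<infinity>j\<in>x ` ?A. pmf \<nu> j * local_time m x j ?A)"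
  proof (rule infsum_cong_neutral)
    fix j assume "j \<in> UNIV - x ` ?A"
    then have "{b\<in>?A. x b = j} = {}" by auto
    then show "pmf \<nu> j * local_time m x j ?A = 0" by (simp only: local_time_def card.empty of_nat_0 div_0 mult_zero_right)
  qed auto
  also have "\<dots> = (\<Sum>j\<in>x ` ?A. pmf \<nu> j * local_time m x j ?A)" by (rule infsum_finite) simp
  also have "\<dots> = (\<Sum>j\<in>x ` ?A. \<Sum>b\<in>{b\<in>?A. x b = j}. real (weight (x b)) / m i)"
  proof (rule sum.cong[OF refl])
    fix j
    have "(\<Sum>b\<in>{b\<in>?A. x b = j}. real (weight (x b)) / m i) = (\<Sum>b\<in>{b\<in>?A. x b = j}. real (weight j) / m i)"
      by (rule sum.cong) auto
    also have "\<dots> = real (card {b\<in>?A. x b = j}) * (real (weight j) / m i)" by simp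
    also have "real (weight j) / m i = pmf \<nu> j / m j"
      unfolding of_nat_weight using mi by simp
    finally show "pmf \<nu> j * local_time m x j ?A = (\<Sum>b\<in>{b\<in>?A. x b = j}. real (weight (x b)) / m i)"
      unfolding local_time_def by simp
  qed
  also have "\<dots> = (\<Sum>b\<in>?A. real (weight (x b)) / m i)"
    by (rule sum.image_gen[symmetric]) simp
  finally have R: "(\<Sum>\<^sub>\<infinity>j. pmf \<nu> j * local_time m x j ?A) = (\<Sum>b\<in>?A. real (weight (x b))) / m i"
    by (simp add: sum_divide_distrib)
  have "real (card {b\<in>?A. x b = i}) = (\<Sum>b\<in>{b\<in>?A. x b = i}. 1)" by (simp only: real_of_card)
  also have "\<dots> = (\<Sum>b\<in>?A. if x b = i then 1 else 0)" by (rule sum.inter_filter) simp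
  also have "\<dots> = (\<Sum>b\<in>?A. of_bool (x b = i))" by (simp only: of_bool_def)
  finally have L: "local_time m x i ?A = (\<Sum>b\<in>?A. of_bool (x b = i)) / m i"
    unfolding local_time_def by (simp only:)
  have "real_of_int (path_sum x n) = (\<Sum>b\<in>?A. real (weight (x b))) - (\<Sum>b\<in>?A. of_bool (x b = i))"
    unfolding path_sum_def incr_def by (simp add: sum_subtractf)
  then have "0 \<le> path_sum x n \<longleftrightarrow> (\<Sum>b\<in>?A. of_bool (x b = i)) \<le> (\<Sum>b\<in>?A. real (weight (x b)))"
    by linarith
  then show ?thesis unfolding R L using mi by (simp add: divide_le_cancel)
qed

lemma T_star_eq_enat_iff:
  "T_star m i \<nu> x = enat n \<longleftrightarrow> 0 \<le> path_sum x n \<and> (\<forall>k<n. path_sum x k < 0)"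
  unfolding T_star_def local_time_le_iff INF_enat_eq_iff by (simp add: not_le)

lemma path_sum_measurable:
  "(\<lambda>x. path_sum x n) \<in> measurable (PiM UNIV (\<lambda>_. count_space UNIV)) (count_space UNIV)"
proof -
  have "(\<lambda>x. map (\<lambda>k. x k) [0..int n])
      \<in> measurable (PiM UNIV (\<lambda>_. count_space (UNIV :: 's set))) (count_space UNIV)"
    by (rule measurable_map_list[where U="\<lambda>k x. x k"]) simp
  then have "(\<lambda>x. sum_list (map incr (map (\<lambda>k. x k) [0..int n])))
      \<in> measurable (PiM UNIV (\<lambda>_. count_space (UNIV :: 's set))) (count_space UNIV)"
    by (rule measurable_compose) simp
  moreover have "sum_list (map incr (map (\<lambda>k. x k) [0..int n])) = path_sum x n" for x
    unfolding path_sum_def map_map by (simp add: interv_sum_list_conv_sum_set_int)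
  ultimately show ?thesis by (simp only:)
qed

lemma T_star_measurable:
  "T_star m i \<nu> \<in> measurable (PiM UNIV (\<lambda>_. count_space UNIV)) (count_space UNIV)"
proof -
  let ?P = "PiM UNIV (\<lambda>_::int. count_space (UNIV :: 's set))"
  have eq: "{x\<in>space ?P. T_star m i \<nu> x = enat n} \<in> sets ?P" for n
  proof -
    have "{x\<in>space ?P. 0 \<le> path_sum x n} \<in> sets ?P" for n
      using measurable_sets[OF path_sum_measurable, of "{0..}" n] by (simp add: vimage_def Int_def conj_commute)
    moreover have "{x\<in>space ?P. path_sum x n < 0} \<in> sets ?P" for n
      using measurable_sets[OF path_sum_measurable, of "{..<0}" n] by (simp add: vimage_def Int_def conj_commute)
    ultimately show ?thesis
      unfolding T_star_eq_enat_iff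
      by (intro sets.sets_Collect_conj sets.sets_Collect_countable_All sets.sets_Collect_imp sets.sets_Collect_const)
  qed
  have "{x\<in>space ?P. T_star m i \<nu> x = t} \<in> sets ?P" for t
  proof (cases t)
    case (enat n)
    then show ?thesis using eq by simp
  next
    case infinity
    have "space ?P - (\<Union>n. {x\<in>space ?P. T_star m i \<nu> x = enat n}) \<in> sets ?P"
      by (intro sets.Diff sets.top sets.countable_UN) (auto simp: eq)
    also have "space ?P - (\<Union>n. {x\<in>space ?P. T_star m i \<nu> x = enat n}) = {x\<in>space ?P. T_star m i \<nu> x = \<infinity>}"
    proof -
      have "T_star m i \<nu> x = \<infinity> \<longleftrightarrow> (\<forall>n. T_star m i \<nu> x \<noteq> enat n)" for x
        by (cases "T_star m i \<nu> x") auto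
      then show ?thesis by auto
    qed
    finally show ?thesis using infinity by simp
  qed
  then show ?thesis
    unfolding measurable_count_space_eq2_countable
    by (auto simp: vimage_def Int_def conj_commute)
qed

definition T :: "'w \<Rightarrow> enat" where
  "T \<omega> = T_star m i \<nu> (\<lambda>n. X n \<omega>)"

definition stopped :: "nat \<Rightarrow> 'w set" where
  "stopped n = {\<omega>\<in>space M. T \<omega> = enat n}"

lemma stopped_eq: "stopped n = {\<omega>\<in>space M. 0 \<le> partial_sum n \<omega> \<and> (\<forall>k<n. partial_sum k \<omega> < 0)}"
  unfolding stopped_def T_def T_star_eq_enat_iff path_sum_def partial_sum_def ..

lemma partial_sum_cong:
  assumes "\<And>k. 0 \<le> k \<Longrightarrow> k \<le> int n \<Longrightarrow> X k \<omega> = X k \<omega>'"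
  shows "partial_sum n \<omega> = partial_sum n \<omega>'"
proof -
  have "incr (X b \<omega>) = incr (X b \<omega>')" if "b \<in> {0..int n}" for b
    by (rule arg_cong[OF assms]) (use that in simp_all)
  then show ?thesis unfolding partial_sum_def by (rule sum.cong[OF refl])
qed

lemma determined_stopped: "determined 0 n (stopped n)"
  unfolding stopped_eq
proof (rule determinedI)
  fix \<omega> \<omega>' assume eq: "\<And>k. - int 0 \<le> k \<Longrightarrow> k \<le> int n \<Longrightarrow> X k \<omega> = X k \<omega>'"
    and H: "0 \<le> partial_sum n \<omega> \<and> (\<forall>k<n. partial_sum k \<omega> < 0)"
  have "partial_sum k \<omega>' = partial_sum k \<omega>" if "k \<le> n" for k
    by (rule sym, rule partial_sum_cong, rule eq) (use that in simp_all)
  with H show "0 \<le> partial_sum n \<omega>' \<and> (\<forall>k<n. partial_sum k \<omega>' < 0)" by simp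
qed

lemma stopped_sets: "stopped n \<in> sets M"
  by (rule determined_sets[OF determined_stopped])

lemma stopped_disjoint: "disjoint_family stopped"
  unfolding disjoint_family_on_def stopped_def by auto

lemma AE_T_finite: "AE \<omega> in M. T \<omega> \<noteq> \<infinity>"
  using AE_partial_sum_nonneg
proof eventually_elim
  case (elim \<omega>)
  then obtain n where n: "0 \<le> partial_sum n \<omega>" by blast
  define k where "k = (LEAST n. 0 \<le> partial_sum n \<omega>)"
  have "0 \<le> partial_sum k \<omega>" unfolding k_def by (rule LeastI[of "\<lambda>n. 0 \<le> partial_sum n \<omega>", OF n])
  moreover have "partial_sum l \<omega> < 0" if "l < k" for l
    using not_less_Least[of l "\<lambda>n. 0 \<le> partial_sum n \<omega>"] that unfolding k_def by simp
  ultimately have "T \<omega> = enat k"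
    unfolding T_def T_star_eq_enat_iff path_sum_def partial_sum_def by simp
  then show ?case by simp
qed

lemma T_measurable: "T \<in> measurable M (count_space UNIV)"
proof -
  have "(\<lambda>\<omega> n. X n \<omega>) \<in> measurable M (PiM UNIV (\<lambda>_. count_space UNIV))"
    by (intro measurable_PiM_single') (auto simp: X_measurable)
  from measurable_compose[OF this T_star_measurable] show ?thesis
    by (simp only: T_def[abs_def])
qed

lemma shift_measurable: "shift_by X T n \<in> measurable M (count_space UNIV)"
proof -
  have "(\<lambda>\<omega>. X (n + int (the_enat (T \<omega>))) \<omega>) \<in> measurable M (count_space UNIV)"
    by (rule measurable_compose_countable[where f="\<lambda>t \<omega>. X (n + int (the_enat t)) \<omega>"])
       (simp_all add: X_measurable T_measurable)
  then show ?thesis by (simp only: shift_by_def[abs_def])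
qed

text \<open>
  Read a trajectory backwards from time \<open>n\<close> as \<open>x\<close>. The shift started at a visit to \<open>i\<close> stops
  \<open>n\<close> steps later exactly if the backward sums reach a new strict minimum at that visit which is
  still nonnegative, so at most \<open>weight (x 0)\<close> visits are matched to the final state.
\<close>
definition matched :: "(nat \<Rightarrow> 's) \<Rightarrow> nat \<Rightarrow> bool" where
  "matched x n \<longleftrightarrow> x n = i \<and> 0 \<le> (\<Sum>a\<le>n. incr (x a))
     \<and> (\<forall>b<n. (\<Sum>a\<le>n. incr (x a)) < (\<Sum>a\<le>b. incr (x a)))"

text \<open>Matched positions are strict running minima, so the backward sums there are distinct.
  These are nonnegative and lie strictly below the sum at position 0, which is at most
  \<open>weight (x 0)\<close>. Position 0 itself cannot be matched, since \<open>x 0 = i\<close>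
  would make its sum -1.\<close>

lemma card_matched_le: "card {n\<in>{..<N}. matched x n} \<le> weight (x 0)"
proof -
  let ?r = "\<lambda>n. \<Sum>a\<le>n. incr (x a)"
  have "inj_on ?r {n\<in>{..<N}. matched x n}"
  proof (rule inj_onI)
    fix n n' assume n: "n \<in> {n\<in>{..<N}. matched x n}" "n' \<in> {n\<in>{..<N}. matched x n}" "?r n = ?r n'"
    show "n = n'"
    proof (rule linorder_cases[of n n'])
      assume "n < n'"
      then have "?r n' < ?r n" using n(2) unfolding matched_def by blast
      then show ?thesis using n(3) by simp
    next
      assume "n' < n"
      then have "?r n < ?r n'" using n(1) unfolding matched_def by blast
      then show ?thesis using n(3) by simp
    qed
  qed
  moreover have "?r ` {n\<in>{..<N}. matched x n} \<subseteq> {0..<int (weight (x 0))}"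
  proof (rule image_subsetI)
    fix n assume "n \<in> {n\<in>{..<N}. matched x n}"
    then have n: "matched x n" by simp
    have "n \<noteq> 0"
    proof
      assume "n = 0"
      then show False using n weight_start unfolding matched_def by (auto simp: incr_def)
    qed
    then have "?r n < ?r 0" using n unfolding matched_def by blast
    also have "?r 0 \<le> int (weight (x 0))" by (simp add: incr_def)
    finally show "?r n \<in> {0..<int (weight (x 0))}" using n unfolding matched_def by simp
  qed
  ultimately have "card {n\<in>{..<N}. matched x n} \<le> card {0..<int (weight (x 0))}"
    by (rule card_inj_on_le) simp
  then show ?thesis by simp
qed

text \<open>A forward sum up to \<open>k < n\<close> is a difference of backward sums, the one at
  \<open>n\<close> minus the one at \<open>n - Suc k\<close>. Its negativity says that the backward
  sum at \<open>n\<close> lies below every earlier one.\<close>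

lemma stopped_imp_matched:
  assumes \<omega>: "\<omega> \<in> stopped n" and x: "\<And>a. a \<le> n \<Longrightarrow> X (int n - int a) \<omega> = x a" and "x n = i"
  shows "matched x n"
proof -
  have sum: "partial_sum k \<omega> = (\<Sum>a=n-k..n. incr (x a))" if "k \<le> n" for k
  proof -
    have "partial_sum k \<omega> = (\<Sum>b\<in>int ` {0..k}. incr (X b \<omega>))"
      unfolding partial_sum_def image_int_atLeastAtMost by simp
    also have "\<dots> = (\<Sum>b=0..k. incr (X (int b) \<omega>))"
      by (simp add: sum.reindex)
    also have "\<dots> = (\<Sum>b=0..k. incr (x (n - b)))"
    proof (rule sum.cong[OF refl])
      fix b assume "b \<in> {0..k}"
      then have "b \<le> n" using that by simp
      then show "incr (X (int b) \<omega>) = incr (x (n - b))" using x[of "n - b"] by simp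
    qed
    also have "\<dots> = (\<Sum>a=n-k..n. incr (x a))"
      by (rule sum.reindex_bij_witness[of _ "\<lambda>a. n - a" "\<lambda>b. n - b"]) (use that in auto)
    finally show ?thesis .
  qed
  have total: "(\<Sum>a\<le>n. incr (x a)) = partial_sum n \<omega>"
    using sum[of n] by (simp add: atMost_atLeast0)
  moreover have "(\<Sum>a\<le>n. incr (x a)) < (\<Sum>a\<le>b. incr (x a))" if "b < n" for b
  proof -
    define k where "k = n - Suc b"
    have k: "k < n" "n - k = Suc b" using that unfolding k_def by auto
    have "{..n} = {..b} \<union> {Suc b..n}" using that by auto
    then have "(\<Sum>a\<le>n. incr (x a)) = (\<Sum>a\<le>b. incr (x a)) + (\<Sum>a=Suc b..n. incr (x a))"
      by (simp only:) (rule sum.union_disjoint, auto)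
    also have "(\<Sum>a=Suc b..n. incr (x a)) = partial_sum k \<omega>" using sum[of k] k by simp
    also have "partial_sum k \<omega> < 0" using \<omega> k(1) unfolding stopped_eq by blast
    finally show ?thesis by simp
  qed
  ultimately show ?thesis using \<omega> \<open>x n = i\<close> unfolding matched_def stopped_eq by simp
qed

section \<open>Law of the past at the stopping time\<close>

definition stopped_past :: "nat \<Rightarrow> nat \<Rightarrow> (nat \<Rightarrow> 's) \<Rightarrow> 'w set" where
  "stopped_past n l x = {\<omega>\<in>stopped n. \<forall>a\<le>l. X (int n - int a) \<omega> = x a}"

lemma determined_stopped_past: "determined l n (stopped_past n l x)"
  unfolding stopped_past_def
proof (rule determined_Collect)
  show "determined l n (stopped n)" by (rule determined_mono[OF determined_stopped]) simp_all
  fix \<omega> \<omega>' assume eq: "\<And>k. - int l \<le> k \<Longrightarrow> k \<le> int n \<Longrightarrow> X k \<omega> = X k \<omega>'"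
    and H: "\<forall>a\<le>l. X (int n - int a) \<omega> = x a"
  show "\<forall>a\<le>l. X (int n - int a) \<omega>' = x a"
  proof (intro allI impI)
    fix a assume a: "a \<le> l"
    have "X (int n - int a) \<omega> = X (int n - int a) \<omega>'" by (rule eq) (use a in simp_all)
    then show "X (int n - int a) \<omega>' = x a" using H a by simp
  qed
qed

lemma stopped_past_sets: "stopped_past n l x \<in> sets M"
  by (rule determined_sets[OF determined_stopped_past])

definition dual_law :: "nat \<Rightarrow> (nat \<Rightarrow> 's) \<Rightarrow> ennreal" where
  "dual_law l x = ennreal (pmf \<nu> (x 0) * (\<Prod>a<l. dual_matrix p m (x a) (x (Suc a))))"

text \<open>With \<open>N \<le> l\<close> the reversed path reaches back to time 0 for every
  \<open>n < N\<close>. Each \<open>n\<close> then contributes at most the same constant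
  \<open>c\<close>, and nothing unless it is matched. At most \<open>weight (x 0)\<close> of them
  are, and the factor \<open>m (x 0) / m i\<close> in \<open>c\<close> turns that number into
  \<open>pmf \<nu> (x 0)\<close>.\<close>

lemma sum_stopped_past_le_long:
  assumes "N \<le> l"
  shows "(\<Sum>n<N. emeasure M (stopped_past n l x)) \<le> dual_law l x"
proof -
  define c where "c = m (x 0) / m i * (\<Prod>a<l. dual_matrix p m (x a) (x (Suc a)))"
  have c: "0 \<le> c" unfolding c_def using m_pos dual_nonneg
    by (intro mult_nonneg_nonneg divide_nonneg_nonneg prod_nonneg) (auto simp: less_imp_le)
  have bound: "emeasure M (stopped_past n l x) \<le> (if matched x n then ennreal c else 0)" if "n < N" for n
  proof -
    let ?R = "{\<omega>\<in>space M. \<forall>a\<le>l. X (int n - int a) \<omega> = x a}"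
    have R: "?R \<in> sets M"
      using measurable_cylinder[of "\<lambda>a. X (int n - int a)" M "{..l}" x] X_measurable by simp
    have "stopped_past n l x \<subseteq> ?R" unfolding stopped_past_def stopped_def by blast
    then have le: "emeasure M (stopped_past n l x) \<le> emeasure M ?R" by (rule emeasure_mono[OF _ R])
    have prob_R: "prob ?R = of_bool (x n = i) * (m (x 0) / m i) * (\<Prod>a<l. dual_matrix p m (x a) (x (Suc a)))"
      by (rule prob_reversed_path) (use that assms in simp)
    show ?thesis
    proof (cases "x n = i")
      case True
      then have R_c: "emeasure M ?R = ennreal c" using prob_R by (simp add: emeasure_eq_measure c_def)
      show ?thesis
      proof (cases "matched x n")
        case True
        then show ?thesis using le R_c by simp
      next
        case False
        have "stopped_past n l x = {}"
        proof (rule equals0I)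
          fix \<omega> assume "\<omega> \<in> stopped_past n l x"
          then have "matched x n"
            using that assms \<open>x n = i\<close> unfolding stopped_past_def
            by (intro stopped_imp_matched[of \<omega>]) simp_all
          then show False using False by simp
        qed
        then show ?thesis by simp
      qed
    next
      case False
      then have "emeasure M ?R = 0" using prob_R by (simp add: emeasure_eq_measure)
      then show ?thesis using le by simp
    qed
  qed
  have "(\<Sum>n<N. emeasure M (stopped_past n l x)) \<le> (\<Sum>n<N. if matched x n then ennreal c else 0)"
    by (rule sum_mono) (use bound in simp)
  also have "\<dots> = of_nat (card {n\<in>{..<N}. matched x n}) * ennreal c"
    by (subst sum.inter_filter[symmetric]) simp_all
  also have "\<dots> \<le> of_nat (weight (x 0)) * ennreal c"
    by (intro mult_right_mono of_nat_mono card_matched_le) simp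
  also have "\<dots> = ennreal (real (weight (x 0)) * c)"
    using c by (simp add: ennreal_mult' ennreal_of_nat_eq_real_of_nat)
  also have "real (weight (x 0)) * c = pmf \<nu> (x 0) * (\<Prod>a<l. dual_matrix p m (x a) (x (Suc a)))"
    unfolding of_nat_weight c_def using m_pos[of i] m_pos[of "x 0"] by simp
  finally show ?thesis unfolding dual_law_def .
qed

lemma stopped_past_split:
  "emeasure M (stopped_past n l x)
    = (\<integral>\<^sup>+y. emeasure M (stopped_past n (Suc l) (x(Suc l := y))) \<partial>count_space UNIV)"
proof -
  have "{\<omega>\<in>stopped_past n l x. X (int n - int (Suc l)) \<omega> = y} = stopped_past n (Suc l) (x(Suc l := y))" for y
  proof -
    have "(\<forall>a\<le>Suc l. X (int n - int a) \<omega> = (x(Suc l := y)) a)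
      \<longleftrightarrow> (\<forall>a\<le>l. X (int n - int a) \<omega> = x a) \<and> X (int n - int (Suc l)) \<omega> = y" for \<omega>
      by (simp add: all_conj_distrib le_Suc_eq imp_conjL del: of_nat_Suc)
    then show ?thesis unfolding stopped_past_def by (simp only: mem_Collect_eq conj_assoc)
  qed
  moreover have "emeasure M (stopped_past n l x)
      = emeasure M {\<omega>\<in>stopped_past n l x. X (int n - int (Suc l)) \<omega> \<in> UNIV}" by simp
  ultimately show ?thesis
    using countable_fibre_sum[of "X (int n - int (Suc l))" "stopped_past n l x" UNIV,
        OF X_measurable stopped_past_sets]
    by (simp only:)
qed

lemma dual_law_split: "dual_law l x = (\<integral>\<^sup>+y. dual_law (Suc l) (x(Suc l := y)) \<partial>count_space UNIV)"
proof -
  have "dual_law (Suc l) (x(Suc l := y)) = dual_law l x * ennreal (dual_matrix p m (x l) y)" for y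
  proof -
    have "(\<Prod>a<l. dual_matrix p m ((x(Suc l := y)) a) ((x(Suc l := y)) (Suc a)))
        = (\<Prod>a<l. dual_matrix p m (x a) (x (Suc a)))"
      by (rule prod.cong) auto
    then show ?thesis
      unfolding dual_law_def prod.lessThan_Suc by (simp add: ennreal_mult''[OF dual_nonneg] mult.assoc[symmetric])
  qed
  then show ?thesis by (simp add: nn_integral_cmult nn_integral_dual_row)
qed

text \<open>The restriction \<open>N \<le> l\<close> is removed by induction on the missing length
  \<open>d\<close>: prolonging the path by one step into the past and summing over the new state
  preserves both sides.\<close>

lemma sum_stopped_past_le: "(\<Sum>n<N. emeasure M (stopped_past n l x)) \<le> dual_law l x"
proof -
  have "N \<le> l + d \<Longrightarrow> (\<Sum>n<N. emeasure M (stopped_past n l x)) \<le> dual_law l x" for d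
  proof (induction d arbitrary: l x)
    case 0
    then show ?case by (simp add: sum_stopped_past_le_long)
  next
    case (Suc d)
    have "(\<Sum>n<N. emeasure M (stopped_past n l x))
      = (\<integral>\<^sup>+y. (\<Sum>n<N. emeasure M (stopped_past n (Suc l) (x(Suc l := y)))) \<partial>count_space UNIV)"
      by (subst stopped_past_split) (simp add: nn_integral_sum)
    also have "\<dots> \<le> (\<integral>\<^sup>+y. dual_law (Suc l) (x(Suc l := y)) \<partial>count_space UNIV)"
      by (rule nn_integral_mono) (use Suc in simp)
    finally show ?case unfolding dual_law_split[of l x] .
  qed
  from this[of N] show ?thesis by simp
qed

lemma suminf_stopped: "(\<Sum>n. emeasure M (stopped n)) = 1"
proof -
  have "(\<Sum>n. emeasure M (stopped n)) = emeasure M (\<Union>n. stopped n)"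
    using stopped_sets stopped_disjoint by (intro suminf_emeasure) auto
  also have "\<dots> = emeasure M (space M)"
  proof (rule emeasure_eq_AE)
    show "AE \<omega> in M. \<omega> \<in> (\<Union>n. stopped n) \<longleftrightarrow> \<omega> \<in> space M"
      using AE_T_finite by eventually_elim (auto simp: stopped_def)
  qed (use stopped_sets in auto)
  finally show ?thesis by (simp add: emeasure_space_1)
qed

text \<open>
  Both sides are sub-probability weights on paths of length \<open>l\<close> with the same total mass,
  so the inequality has no room.
\<close>
lemma suminf_stopped_past: "(\<Sum>n. emeasure M (stopped_past n l x)) = dual_law l x"
proof -
  have le: "(\<Sum>n. emeasure M (stopped_past n l x)) \<le> dual_law l x" for l x
    by (intro suminf_le_const summableI sum_stopped_past_le)
  show ?thesis
  proof (induction l arbitrary: x)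
    case 0
    let ?f = "\<lambda>j. \<Sum>n. emeasure M (stopped_past n 0 (\<lambda>_. j))"
    have eq: "stopped_past n 0 x = {\<omega>\<in>stopped n. X (int n) \<omega> = x 0}" for n x
      unfolding stopped_past_def by simp
    have "(\<integral>\<^sup>+j. ?f j \<partial>count_space UNIV)
        = (\<Sum>n. \<integral>\<^sup>+j. emeasure M {\<omega>\<in>stopped n. X (int n) \<omega> = j} \<partial>count_space UNIV)"
      unfolding eq by (rule nn_integral_suminf) simp
    also have "\<dots> = (\<Sum>n. emeasure M (stopped n))"
    proof (rule arg_cong[where f=suminf], rule ext)
      fix n
      show "(\<integral>\<^sup>+j. emeasure M {\<omega>\<in>stopped n. X (int n) \<omega> = j} \<partial>count_space UNIV) = emeasure M (stopped n)"
        using countable_fibre_sum[of "X (int n)" "stopped n" UNIV, OF X_measurable stopped_sets] by simp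
    qed
    finally have f: "(\<integral>\<^sup>+j. ?f j \<partial>count_space UNIV) = 1" unfolding suminf_stopped .
    have g: "(\<integral>\<^sup>+j. dual_law 0 (\<lambda>_. j) \<partial>count_space UNIV) = 1"
      unfolding dual_law_def
      by (simp add: nn_integral_pmf measure_pmf.emeasure_space_1[simplified])
    have "?f (x 0) = dual_law 0 (\<lambda>_. x 0)"
      by (rule nn_integral_count_space_eq_imp_eq[of ?f "\<lambda>j. dual_law 0 (\<lambda>_. j)"])
         (simp_all add: le f g)
    then show ?case by (simp add: eq dual_law_def)
  next
    case (Suc l)
    \<comment> \<open>Equality is propagated one coordinate at a time: by the induction hypothesis
      the values over all prolongations \<open>y\<close> have the same finite sum on both sides, so
      the termwise inequality is an equality.\<close>
    let ?f = "\<lambda>y. \<Sum>n. emeasure M (stopped_past n (Suc l) (x(Suc l := y)))"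
    let ?g = "\<lambda>y. dual_law (Suc l) (x(Suc l := y))"
    have "(\<integral>\<^sup>+y. ?f y \<partial>count_space UNIV) = (\<Sum>n. emeasure M (stopped_past n l x))"
      by (subst stopped_past_split) (rule nn_integral_suminf, simp)
    also have "\<dots> = (\<integral>\<^sup>+y. ?g y \<partial>count_space UNIV)"
      unfolding Suc.IH by (rule dual_law_split)
    finally have "?f (x (Suc l)) = ?g (x (Suc l))"
    proof (rule nn_integral_count_space_eq_imp_eq[rotated])
      show "(\<integral>\<^sup>+y. ?g y \<partial>count_space UNIV) \<noteq> \<top>"
        unfolding dual_law_split[symmetric] by (simp add: dual_law_def)
    qed (rule le)
    then show ?case by (simp only: fun_upd_triv)
  qed
qed

section \<open>The future after the stopping time and the law of the shifted chain\<close>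

lemma emeasure_stopped_past_future:
  assumes "x 0 = z 0"
  shows "emeasure M {\<omega>\<in>stopped_past n l x. \<forall>b\<le>k. X (int (n + b)) \<omega> = z b}
    = emeasure M (stopped_past n l x) * ennreal (\<Prod>b<k. p (z b) (z (Suc b)))"
proof (induction k)
  case 0
  \<comment> \<open>Time \<open>n\<close> belongs to both the past and the future;
    \<open>x 0 = z 0\<close> makes the two requirements on it agree.\<close>
  have "{\<omega>\<in>stopped_past n l x. \<forall>b\<le>0. X (int (n + b)) \<omega> = z b} = stopped_past n l x"
    using assms unfolding stopped_past_def by auto
  then show ?case by simp
next
  case (Suc k)
  let ?A = "\<lambda>k. {\<omega>\<in>stopped_past n l x. \<forall>b\<le>k. X (int (n + b)) \<omega> = z b}"
  have A: "determined l (n + k) (?A k)"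
  proof (rule determined_Collect)
    show "determined l (n + k) (stopped_past n l x)"
      by (rule determined_mono[OF determined_stopped_past]) simp_all
    fix \<omega> \<omega>' assume eq: "\<And>r. - int l \<le> r \<Longrightarrow> r \<le> int (n + k) \<Longrightarrow> X r \<omega> = X r \<omega>'"
      and H: "\<forall>b\<le>k. X (int (n + b)) \<omega> = z b"
    show "\<forall>b\<le>k. X (int (n + b)) \<omega>' = z b"
    proof (intro allI impI)
      fix b assume b: "b \<le> k"
      have "X (int (n + b)) \<omega> = X (int (n + b)) \<omega>'" by (rule eq) (use b in simp_all)
      then show "X (int (n + b)) \<omega>' = z b" using H b by simp
    qed
  qed
  have "?A (Suc k) = {\<omega>\<in>?A k. X (int (n + k)) \<omega> = z k \<and> X (int (Suc (n + k))) \<omega> = z (Suc k)}"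
  proof -
    have "(\<forall>b\<le>Suc k. X (int (n + b)) \<omega> = z b) \<longleftrightarrow> (\<forall>b\<le>k. X (int (n + b)) \<omega> = z b)
        \<and> X (int (n + k)) \<omega> = z k \<and> X (int (Suc (n + k))) \<omega> = z (Suc k)" for \<omega>
      unfolding le_Suc_eq add_Suc_right[symmetric] by blast
    then show ?thesis by (simp only: mem_Collect_eq conj_assoc)
  qed
  then have "emeasure M (?A (Suc k)) = emeasure M {\<omega>\<in>?A k. X (int (n + k)) \<omega> = z k} * ennreal (p (z k) (z (Suc k)))"
    by (simp only: markov_step[OF A])
  also have "{\<omega>\<in>?A k. X (int (n + k)) \<omega> = z k} = ?A k" by auto
  finally show ?case
    unfolding Suc.IH by (simp add: ennreal_mult''[OF p_nonneg] mult.assoc)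
qed

text \<open>The event is decomposed by the value \<open>n\<close> of \<open>T\<close>, the case
  \<open>T = \<infinity>\<close> being null. On \<open>T = n\<close> the shifted path is the
  original one recentred at \<open>n\<close>. The future factor does not depend on \<open>n\<close>,
  so it comes out of the sum and leaves the law of the past.\<close>

lemma prob_shift_cylinder:
  assumes "x 0 = z 0"
  shows "prob {\<omega>\<in>space M. (\<forall>a\<le>l. shift_by X T (- int a) \<omega> = x a) \<and> (\<forall>b\<le>k. shift_by X T (int b) \<omega> = z b)}
    = pmf \<nu> (z 0) * (\<Prod>a<l. dual_matrix p m (x a) (x (Suc a))) * (\<Prod>b<k. p (z b) (z (Suc b)))"
proof -
  let ?C = "{\<omega>\<in>space M. (\<forall>a\<le>l. shift_by X T (- int a) \<omega> = x a) \<and> (\<forall>b\<le>k. shift_by X T (int b) \<omega> = z b)}"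
  let ?A = "\<lambda>n. {\<omega>\<in>stopped_past n l x. \<forall>b\<le>k. X (int (n + b)) \<omega> = z b}"
  have "?C = {\<omega>\<in>space M. \<forall>a\<in>{..l}. shift_by X T (- int a) \<omega> = x a}
      \<inter> {\<omega>\<in>space M. \<forall>b\<in>{..k}. shift_by X T (int b) \<omega> = z b}" by auto
  also have "\<dots> \<in> sets M"
    by (intro sets.Int measurable_cylinder shift_measurable) simp_all
  finally have C: "?C \<in> sets M" .
  have A: "?A n \<in> sets M" for n
  proof -
    have "?A n = stopped_past n l x \<inter> {\<omega>\<in>space M. \<forall>b\<in>{..k}. X (int (n + b)) \<omega> = z b}"
      unfolding stopped_past_def stopped_def by auto
    also have "\<dots> \<in> sets M"
      by (intro sets.Int stopped_past_sets measurable_cylinder X_measurable) simp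
    finally show ?thesis .
  qed
  have A_eq: "\<omega> \<in> ?A n \<longleftrightarrow> \<omega> \<in> ?C \<and> T \<omega> = enat n" for \<omega> n
  proof (cases "\<omega> \<in> space M \<and> T \<omega> = enat n")
    case True
    then have sh: "shift_by X T r \<omega> = X (r + int n) \<omega>" for r unfolding shift_by_def by simp
    have "shift_by X T (- int a) \<omega> = X (int n - int a) \<omega>" "shift_by X T (int b) \<omega> = X (int (n + b)) \<omega>" for a b
      unfolding sh by (simp_all add: add.commute)
    then show ?thesis using True unfolding stopped_past_def stopped_def by simp
  next
    case False
    then show ?thesis unfolding stopped_past_def stopped_def by auto
  qed
  have "emeasure M ?C = emeasure M (\<Union>n. ?A n)"
  proof (rule emeasure_eq_AE)
    show "AE \<omega> in M. \<omega> \<in> ?C \<longleftrightarrow> \<omega> \<in> (\<Union>n. ?A n)"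
      using AE_T_finite
    proof eventually_elim
      case (elim \<omega>)
      then obtain n where "T \<omega> = enat n" by auto
      then show ?case unfolding UN_iff A_eq by simp
    qed
    show "?C \<in> sets M" by (rule C)
    show "(\<Union>n. ?A n) \<in> sets M" by (rule sets.countable_UN) (rule image_subsetI, rule A)
  qed
  also have "\<dots> = (\<Sum>n. emeasure M (?A n))"
  proof (rule suminf_emeasure[symmetric])
    show "disjoint_family ?A"
      unfolding disjoint_family_on_def
    proof (intro ballI impI equals0I)
      fix n n' \<omega> assume "n \<noteq> n'" and \<omega>: "\<omega> \<in> ?A n \<inter> ?A n'"
      have "\<omega> \<in> ?A n" "\<omega> \<in> ?A n'" using IntD1[OF \<omega>] IntD2[OF \<omega>] .
      then have "T \<omega> = enat n" "T \<omega> = enat n'" by (simp_all only: A_eq)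
      then show False using \<open>n \<noteq> n'\<close> by simp
    qed
    show "range ?A \<subseteq> sets M" by (rule image_subsetI) (rule A)
  qed
  also have "\<dots> = dual_law l x * ennreal (\<Prod>b<k. p (z b) (z (Suc b)))"
    unfolding emeasure_stopped_past_future[of x z, OF assms] by (simp add: suminf_stopped_past)
  also have "\<dots> = ennreal (pmf \<nu> (z 0) * (\<Prod>a<l. dual_matrix p m (x a) (x (Suc a)))
      * (\<Prod>b<k. p (z b) (z (Suc b))))"
    unfolding dual_law_def assms
    by (rule ennreal_mult''[symmetric]) (simp add: prod_nonneg p_nonneg)
  finally show ?thesis
    unfolding emeasure_eq_measure
    by (subst (asm) ennreal_inj)
       (auto intro!: mult_nonneg_nonneg prod_nonneg simp: p_nonneg dual_nonneg)
qed

lemma two_sided_shift: "two_sided_markov_chain M p m \<nu> (shift_by X T)"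
  by (rule two_sided_markov_chainI[OF prob_space_axioms shift_measurable prob_shift_cylinder])

lemma nonrandomized_T: "nonrandomized M X T"
  unfolding nonrandomized_def T_def using T_star_measurable by blast

lemma stopping_time_T: "chain_stopping_time M X T"
  unfolding chain_stopping_time_def
  using determined_sigma_sets[OF determined_stopped] unfolding stopped_def by blast

end

theorem theorem2:
  fixes p :: "('s::countable) matrix" and m :: "'s \<Rightarrow> real" and i :: 's and \<nu> :: "'s pmf"
    and M :: "'w measure" and X :: "int \<Rightarrow> 'w \<Rightarrow> 's"
  assumes "transition_matrix p"
    and "irreducible_matrix p"
    and "recurrent_matrix p"
    and "stationary_measure p m"
    and "two_sided_markov_chain M p m (return_pmf i) X"
    and "pmf \<nu> i = 0"
    and "\<And>j. m i / m j * pmf \<nu> j \<in> \<int>"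
  defines "T \<equiv> (\<lambda>\<omega>. T_star m i \<nu> (\<lambda>n. X n \<omega>))"
  shows "(AE \<omega> in M. T \<omega> \<noteq> \<infinity>) \<and>
    nonrandomized M X T \<and>
    chain_stopping_time M X T \<and>
    two_sided_markov_chain M p m \<nu> (shift_by X T)"
proof -
  interpret prob_space M using assms(5) unfolding two_sided_markov_chain_def by simp
  interpret S: shift_setting M p m i X \<nu>
    by unfold_locales (use assms in simp_all)
  have "T = S.T" unfolding T_def S.T_def[abs_def] ..
  then show ?thesis
    using S.AE_T_finite S.nonrandomized_T S.stopping_time_T S.two_sided_shift by simp
qed

end
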